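(* Let $m,n\ge 2$. The large cells form a polyhedral subdivision of $B_{m,n}=\mathrm{Im}(g)\subset\mathbb{R}^{m\times n}$. The small cells also form a polyhedral subdivision of $B_{m,n}$, and it is finer than (i.e. a refinement of) the subdivision into large cells.
   Context: The map $g:\mathbb{R}^{2(m+n)}\to\mathbb{R}^{m\times n}$ sends $(a,A,b,B)$, with $a,A\in\mathbb{R}^m$ and $b,B\in\mathbb{R}^n$, to the $m\times n$ matrix with entries $g_{ij}=\min(a_i+b_j,\,A_i+B_j)$. Its image is denoted $B_{m,n}$ (the set of real $m\times n$ matrices of Barvinok rank at most $2$). Put $x_i=a_i-A_i$ and $y_j=B_j-b_j$. Let $\mathcal{A}_{m,n}$ be the hyperplane arrangement in $\mathbb{R}^{2(m+n)}$ consisting of the hyperplanes $x_i=y_j$ for $1\le i\le m$, $1\le j\le n$. Its regions are the connected components of the complement; on each region $g$ is linear ($g_{ij}=a_i+b_j$ if $x_i<y_j$ on the region, $g_{ij}=A_i+B_j$ if $x_i>y_j$). Label of a region. Each region $R$ is described uniquely by an ordered partition of the set of letters $\{1,\dots,m,\overline{1},\dots,\overline{n}\}$ into nonempty blocks, each consisting only of positive letters $i$ (representing $x_i$) or only of negative letters $\overline{j}$ (representing $y_j$), with consecutive blocks of opposite sign: the region is the set of points such that $x_i<y_j$ if the block of $i$ precedes the block of $\overline{j}$, and $x_i>y_j$ otherwise. $\pi(R)$ denotes the permutation of the letters obtained by reading the blocks from left to right, with letters in increasing order within each block. "Blocks of $\pi(R)$" are these maximal blocks of consecutive letters of the same sign.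 A block is a singleton if it has exactly one letter. Cells. For a region $R$, the associated cell is the closed polyhedron $\overline{g(R)}$, equal to the image under $g$ of the closure of $R$. The cell $\overline{g(R)}$ has the maximum possible dimension $2m+2n-4$ if and only if the first and last blocks of $\pi(R)$ are singletons. A maximum-dimensional cell $\overline{g(R)}$ is called large if neither the second nor the second-to-last block of $\pi(R)$ is a singleton, and small if the second and the second-to-last blocks of $\pi(R)$ are both singletons. (Different regions can give the same cell; for example $\overline{g(R)}=\overline{g(-R)}$. The collections of large cells and of small cells are considered as sets of polyhedra.) A finite collection of polyhedra is a polyhedral subdivision of a set if all the polyhedra are contained in the set, their union is the set, and any two of them intersect in a (possibly empty) common face of both. One subdivision refines another (is finer) if each of its polyhedra is contained in a polyhedron of the other. *)

theory Defs
  imports "HOL-Analysis.Analysis"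
begin

text \<open>The index sets of size \<open>m\<close> and \<open>n\<close> are finite types \<open>'m\<close> and \<open>'n\<close>; a point of the
  parameter space is a quadruple \<open>(a, A, b, B)\<close>.\<close>

type_synonym ('m, 'n) params = "(real^'m) \<times> (real^'m) \<times> (real^'n) \<times> (real^'n)"

definition g :: "('m::finite, 'n::finite) params \<Rightarrow> real^'n^'m" where
  "g = (\<lambda>(a, A, b, B). \<chi> i j. min (a $ i + b $ j) (A $ i + B $ j))"

definition barvinok_set :: "(real^'n^'m) set" where
  "barvinok_set = range (g :: ('m::finite, 'n::finite) params \<Rightarrow> real^'n^'m)"

definition x_coord :: "('m::finite, 'n::finite) params \<Rightarrow> 'm \<Rightarrow> real" where
  "x_coord = (\<lambda>(a, A, b, B) i. a $ i - A $ i)"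

definition y_coord :: "('m::finite, 'n::finite) params \<Rightarrow> 'n \<Rightarrow> real" where
  "y_coord = (\<lambda>(a, A, b, B) j. B $ j - b $ j)"

definition arrangement :: "('m::finite, 'n::finite) params set set" where
  "arrangement = {{p. x_coord p i = y_coord p j} | i j. True}"

definition regions :: "('m::finite, 'n::finite) params set set" where
  "regions = components (- \<Union>arrangement)"

text \<open>The letter \<open>Inl i\<close> is the positive letter \<open>i\<close> and \<open>Inr j\<close> is the negative letter \<open>j\<close>.
  Since blocks are nonempty and of one sign, the condition on consecutive blocks says that
  they have opposite signs.\<close>

definition alternating_partition :: "('m + 'n) set list \<Rightarrow> bool" where
  "alternating_partition w \<longleftrightarrow>
     distinct w \<and> partition_on UNIV (set w) \<and>
     (\<forall>S\<in>set w. S \<subseteq> range Inl \<or> S \<subseteq> range Inr) \<and>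
     successively (\<lambda>S T. S \<subseteq> range Inl \<longleftrightarrow> T \<subseteq> range Inr) w"

definition precedes :: "('m + 'n) set list \<Rightarrow> 'm + 'n \<Rightarrow> 'm + 'n \<Rightarrow> bool" where
  "precedes w s t \<longleftrightarrow> (\<exists>k l. k < l \<and> l < length w \<and> s \<in> w ! k \<and> t \<in> w ! l)"

text \<open>\<open>region_label R w\<close>: the region \<open>R\<close> is described by the ordered partition \<open>w\<close>, whose
  members are the blocks of the permutation \<open>\<pi>(R)\<close>. The order of the letters inside
  a block plays no role.\<close>

definition region_label :: "('m::finite, 'n::finite) params set \<Rightarrow> ('m + 'n) set list \<Rightarrow> bool" where
  "region_label R w \<longleftrightarrow>
     alternating_partition w \<and>
     R = {p. \<forall>i j. if precedes w (Inl i) (Inr j) then x_coord p i < y_coord p j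
                   else x_coord p i > y_coord p j}"

definition cell :: "('m::finite, 'n::finite) params set \<Rightarrow> (real^'n^'m) set" where
  "cell R = closure (g ` R)"

definition max_dimensional :: "(real^'n^'m) set \<Rightarrow> bool" where
  "max_dimensional C \<longleftrightarrow> aff_dim C = 2 * int CARD('m::finite) + 2 * int CARD('n::finite) - 4"

text \<open>The second and the second-to-last block of \<open>w\<close> are \<open>w ! 1\<close> and \<open>w ! (length w - 2)\<close>.
  A label has at least two blocks, since both signs occur, so these indices are in range.
  The two blocks coincide when there are exactly three.\<close>

definition large_cells :: "(real^'n^'m) set set" where
  "large_cells = {cell R | (R :: ('m::finite, 'n::finite) params set) w.
     R \<in> regions \<and> region_label R w \<and> max_dimensional (cell R) \<and>
     \<not> is_singleton (w ! 1) \<and> \<not> is_singleton (w ! (length w - 2))}"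

definition small_cells :: "(real^'n^'m) set set" where
  "small_cells = {cell R | (R :: ('m::finite, 'n::finite) params set) w.
     R \<in> regions \<and> region_label R w \<and> max_dimensional (cell R) \<and>
     is_singleton (w ! 1) \<and> is_singleton (w ! (length w - 2))}"

definition polyhedral_subdivision :: "'a::euclidean_space set set \<Rightarrow> 'a set \<Rightarrow> bool" where
  "polyhedral_subdivision \<C> X \<longleftrightarrow>
     finite \<C> \<and> (\<forall>P\<in>\<C>. polyhedron P) \<and>
     (\<forall>P\<in>\<C>. P \<subseteq> X) \<and> \<Union>\<C> = X \<and>
     (\<forall>P\<in>\<C>. \<forall>Q\<in>\<C>. P \<inter> Q face_of P \<and> P \<inter> Q face_of Q)"

definition refines_subdivision :: "'a set set \<Rightarrow> 'a set set \<Rightarrow> bool" where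
  "refines_subdivision \<C> \<D> \<longleftrightarrow> (\<forall>P\<in>\<C>. \<exists>Q\<in>\<D>. P \<subseteq> Q)"

end

theory Submission imports Defs begin

text \<open>Up to a summand \<open>u i + v j\<close>, the matrix \<open>g p\<close> is \<open>min (x i) (y j)\<close>. The cell of a region with
  order pattern \<open>P i j \<longleftrightarrow> x i < y j\<close> turns out to be cut out by the inequalities
  \<open>M i j + M k l \<le> M i l + M k j\<close> over all \<open>2 \<times> 2\<close> minors on which \<open>P\<close> agrees at \<open>(i, j)\<close>, \<open>(i, l)\<close> and
  \<open>(k, j)\<close>. So cells are polyhedra, and reversing the order of all letters does not change them.

  Moving the coordinates below \<open>lo = max (min x) (min y)\<close> up to \<open>lo\<close>, and those above
  \<open>hi = min (max x) (max y)\<close> down to \<open>hi\<close>, does not change the matrix modulo \<open>u i + v j\<close>. If \<open>lo < hi\<close>,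
  the order of the coordinates so clamped is determined by the matrix up to reversal. Hence two cells
  through a common point agree, possibly after reversing one of them, on all pairs of letters that
  are strictly ordered at that point, and this makes their intersection a face.

  Clamping makes the lowest \<open>x\<close> and the lowest \<open>y\<close> equal, so a matrix does not distinguish their order:
  ordering them suitably puts every matrix into a small cell, and exchanging the first two and the
  last two letters of a small cell embeds it in a large one.\<close>

section \<open>Height functions on letters\<close>

text \<open>A label matters only through comparisons between letters of opposite sign. A real height
  per letter, read only on opposite pairs, therefore replaces it: reversal becomes negation, and
  lists of blocks appear only where \<open>large_cells\<close> and \<open>small_cells\<close> are
  translated.

  The obstacle is the intersection property. The coordinates behind a matrix are not unique, so at a
  common point of two cells the order of the letters is known only after clamping, and letters
  beyond the clamping range may be ordered differently in the two cells. The sizes of the blocks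
  must then supply the face property: if it failed at such a pair, two letters would share the
  second block of one cell. This excludes small cells at once; for large cells it forces the
  alphabet to have just four letters. Two letters of one sign also cause trouble where all clamped
  coordinates coincide. With two rows or two columns, however, a large cell is the whole matrix
  space, because all its inequalities are trivial, and nothing has to be compared.\<close>

definition opp :: "'a + 'b \<Rightarrow> 'a + 'b \<Rightarrow> bool" where
  "opp s t \<longleftrightarrow> isl s \<noteq> isl t"

definition proper :: "('a + 'b \<Rightarrow> real) \<Rightarrow> bool" where
  "proper h \<longleftrightarrow> (\<forall>s t. opp s t \<longrightarrow> h s \<noteq> h t)"

text \<open>The inequality for \<open>z\<close> is weak because a cell is the image of the closure
  of a region; the ties in \<open>z\<close> are what cuts out faces.\<close>

definition compatible :: "('a + 'b \<Rightarrow> real) \<Rightarrow> ('a + 'b \<Rightarrow> real) \<Rightarrow> bool" where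
  "compatible h z \<longleftrightarrow> (\<forall>s t. opp s t \<and> h s < h t \<longrightarrow> z s \<le> z t)"

definition below :: "('a + 'b \<Rightarrow> real) \<Rightarrow> 'a \<Rightarrow> 'b \<Rightarrow> bool" where
  "below h i j \<longleftrightarrow> h (Inl i) < h (Inr j)"

text \<open>If \<open>h\<close> orders the letters as a label does, \<open>bottom h\<close> and \<open>second h\<close> are its first two blocks, and
  \<open>bottom (- h)\<close> and \<open>second (- h)\<close> are its last two.\<close>

definition bottom :: "('a + 'b \<Rightarrow> real) \<Rightarrow> ('a + 'b) set" where
  "bottom h = {s. \<forall>t. opp s t \<longrightarrow> h s < h t}"

definition second :: "('a + 'b \<Rightarrow> real) \<Rightarrow> ('a + 'b) set" where
  "second h = {s. s \<notin> bottom h \<and> (\<forall>t. opp s t \<and> t \<notin> bottom h \<longrightarrow> h s < h t)}"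

definition ends :: "('a + 'b \<Rightarrow> real) \<Rightarrow> bool" where
  "ends h \<longleftrightarrow> is_singleton (bottom h) \<and> is_singleton (bottom (- h))"

definition large :: "('a + 'b \<Rightarrow> real) \<Rightarrow> bool" where
  "large h \<longleftrightarrow> ends h \<and> \<not> is_singleton (second h) \<and> \<not> is_singleton (second (- h))"

definition small :: "('a + 'b \<Rightarrow> real) \<Rightarrow> bool" where
  "small h \<longleftrightarrow> ends h \<and> is_singleton (second h) \<and> is_singleton (second (- h))"

lemma opp_simps [simp]:
  "opp (Inl i) (Inr j)" "opp (Inr j) (Inl i)" "\<not> opp (Inl i) (Inl k)" "\<not> opp (Inr j) (Inr l)"
  by (auto simp: opp_def)

lemma opp_sym: "opp s t \<Longrightarrow> opp t s"
  by (auto simp: opp_def)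

lemma uminus_uminus_fun [simp]: "- (- h) = (h :: 'a \<Rightarrow> real)"
  by (simp add: fun_eq_iff)

lemma proper_uminus [simp]: "proper (- h) \<longleftrightarrow> proper h"
  by (simp add: proper_def)

lemma below_uminus: "proper h \<Longrightarrow> below (- h) i j \<longleftrightarrow> \<not> below h i j"
  unfolding below_def proper_def uminus_apply
  by (metis linorder_less_linear neg_less_iff_less opp_simps(1) order_less_asym)

lemma compatible_uminus: "compatible (- h) (- z) \<longleftrightarrow> compatible h z"
  unfolding compatible_def using opp_sym by fastforce

lemma ends_uminus [simp]: "ends (- h) \<longleftrightarrow> ends h"
  by (auto simp: ends_def)

lemma large_uminus [simp]: "large (- h) \<longleftrightarrow> large h"
  by (auto simp: large_def)

lemma small_uminus [simp]: "small (- h) \<longleftrightarrow> small h"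
  by (auto simp: small_def)

section \<open>Cells as polyhedral cones\<close>

definition cone_of :: "('m::finite \<Rightarrow> 'n::finite \<Rightarrow> bool) \<Rightarrow> (real^'n^'m) set" where
  "cone_of P = {M. \<forall>i k j l. P i j = P i l \<and> P i j = P k j \<longrightarrow>
     M $ i $ j + M $ k $ l \<le> M $ i $ l + M $ k $ j}"

abbreviation cone_at :: "('m::finite + 'n::finite \<Rightarrow> real) \<Rightarrow> (real^'n^'m) set" where
  "cone_at h \<equiv> cone_of (below h)"

definition represents :: "('m::finite + 'n::finite \<Rightarrow> real) \<Rightarrow> real^'n^'m \<Rightarrow> bool" where
  "represents z M \<longleftrightarrow> (\<exists>u v. \<forall>i j. M $ i $ j = u i + v j + min (z (Inl i)) (z (Inr j)))"

text \<open>The inequalities only ask where the pattern takes equal values, and complementing it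
  preserves this.\<close>

lemma cone_at_uminus: "proper h \<Longrightarrow> cone_at (- h) = cone_at h"
  by (simp add: cone_of_def below_uminus)

lemma polyhedron_cone_of: "polyhedron (cone_of P)"
proof -
  have "cone_of P = (\<Inter>(i, k, j, l)\<in>{(i, k, j, l). P i j = P i l \<and> P i j = P k j}.
      {M. (axis i (axis j 1) + axis k (axis l 1) - axis i (axis l 1) - axis k (axis j 1)) \<bullet> M \<le> 0})"
    by (auto simp: cone_of_def inner_add_left inner_diff_left inner_axis' algebra_simps)
  also have "polyhedron \<dots>"
    by (intro polyhedron_Inter) (auto intro: polyhedron_halfspace_le)
  finally show ?thesis .
qed

text \<open>The matrix is a sum \<open>a i + b j\<close> on the bipartite graph \<open>below h\<close>; \<open>a\<close> and \<open>b\<close> are read off the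
  row of the lowest positive letter and the column of the highest negative letter. Letters isolated in
  that graph are unconstrained and get a value large enough for the inequality.\<close>

lemma cone_at_upper_sum:
  fixes M :: "real^'n::finite^'m::finite"
  assumes "proper h" "M \<in> cone_at h"
  shows "\<exists>a b. \<forall>i j. M $ i $ j \<le> a i + b j \<and> (below h i j \<longrightarrow> M $ i $ j = a i + b j)"
proof -
  obtain i0 where i0: "\<And>i. h (Inl i0) \<le> h (Inl i)"
    using ex_min_if_finite[of "range (h \<circ> Inl)"] by (auto simp: not_less)
  obtain j0 where j0: "\<And>j. h (Inr j) \<le> h (Inr j0)"
    using ex_min_if_finite[of "range (\<lambda>j. - h (Inr j))"] by (auto simp: not_less)
  define K where "K = Max (range (\<lambda>(i, j). \<bar>M $ i $ j\<bar>))"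
  have K: "\<bar>M $ i $ j\<bar> \<le> K" for i j
    unfolding K_def by (rule Max_ge) (auto intro!: image_eqI[of _ _ "(i, j)"])
  define a where "a i = (if below h i j0 then M $ i $ j0 else 4 * K)" for i
  define b where "b j = (if below h i0 j then M $ i0 $ j - M $ i0 $ j0 else 4 * K)" for j
  have "M $ i $ j \<le> a i + b j \<and> (below h i j \<longrightarrow> M $ i $ j = a i + b j)" for i j
  proof (cases "below h i j0 \<and> below h i0 j")
    case True
    have c: "below h i0 j0" using True i0[of i] j0[of j] by (auto simp: below_def)
    \<comment> \<open>The minor with corner \<open>(i0, j0)\<close> gives the upper bound. If
      \<open>(i, j)\<close> is an edge too, the pattern is constant on this minor and the reverse
      inequality is also available.\<close>
    have "M $ i0 $ j0 + M $ i $ j \<le> M $ i0 $ j + M $ i $ j0"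
      using assms(2) True c by (auto simp: cone_of_def)
    moreover have "M $ i $ j0 + M $ i0 $ j \<le> M $ i $ j + M $ i0 $ j0" if "below h i j"
      using assms(2) True c that by (auto simp: cone_of_def)
    ultimately show ?thesis using True by (auto simp: a_def b_def)
  next
    case False
    have "\<not> below h i j" using False i0[of i] j0[of j] by (auto simp: below_def)
    then show ?thesis using False K[of i j] K[of i j0] K[of i0 j] K[of i0 j0]
      by (auto simp: a_def b_def)
  qed
  then show ?thesis by blast
qed

text \<open>\<open>cone_at_upper_sum\<close> for \<open>h\<close> and for \<open>- h\<close> gives
  two upper bounds \<open>a + b\<close> and \<open>A + B\<close>, one of them attained at each
  entry. So the matrix is their minimum, that is \<open>g (a, A, b, B)\<close>, and the attained
  bound being the smaller one is exactly compatibility.\<close>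

lemma mem_cone_at_iff:
  fixes M :: "real^'n::finite^'m::finite"
  assumes "proper h"
  shows "M \<in> cone_at h \<longleftrightarrow> (\<exists>z. compatible h z \<and> represents z M)"
proof
  assume M: "M \<in> cone_at h"
  obtain a b where ab: "\<And>i j. M $ i $ j \<le> a i + b j" "\<And>i j. below h i j \<Longrightarrow> M $ i $ j = a i + b j"
    using cone_at_upper_sum[OF assms M] by blast
  obtain A B where AB: "\<And>i j. M $ i $ j \<le> A i + B j"
    "\<And>i j. \<not> below h i j \<Longrightarrow> M $ i $ j = A i + B j"
    using cone_at_upper_sum[of "- h" M] M assms by (auto simp: below_uminus cone_at_uminus)
  define z where "z = case_sum (\<lambda>i. a i - A i) (\<lambda>j. B j - b j)"
  have "compatible h z"
    unfolding compatible_def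
  proof (intro allI impI)
    fix s t assume st: "opp s t \<and> h s < h t"
    show "z s \<le> z t"
    proof (cases s; cases t)
      fix i j assume [simp]: "s = Inl i" "t = Inr j"
      show ?thesis using ab(2)[of i j] AB(1)[of i j] st by (auto simp: z_def below_def)
    next
      fix i j assume [simp]: "s = Inr j" "t = Inl i"
      show ?thesis using AB(2)[of i j] ab(1)[of i j] st by (auto simp: z_def below_def)
    qed (use st in auto)
  qed
  moreover have "M $ i $ j = A i + b j + min (z (Inl i)) (z (Inr j))" for i j
    using ab[of i j] AB[of i j] by (cases "below h i j") (auto simp: z_def)
  then have "represents z M" unfolding represents_def by blast
  ultimately show "\<exists>z. compatible h z \<and> represents z M" by blast
next
  assume "\<exists>z. compatible h z \<and> represents z M"
  then obtain z u v where z: "compatible h z"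
    and M: "\<And>i j. M $ i $ j = u i + v j + min (z (Inl i)) (z (Inr j))"
    by (auto simp: represents_def)
  have 1: "min (z (Inl i)) (z (Inr j)) = z (Inl i)" if "below h i j" for i j
    using z that by (auto simp: compatible_def below_def min_def)
  have 2: "min (z (Inl i)) (z (Inr j)) = z (Inr j)" if "\<not> below h i j" for i j
    using z that assms unfolding compatible_def below_def proper_def
    by (metis linorder_neq_iff min.absorb2 opp_simps(2))
  show "M \<in> cone_at h"
    unfolding cone_of_def
  proof (clarify)
    fix i k j l assume P: "below h i j = below h i l" "below h i j = below h k j"
    show "M $ i $ j + M $ k $ l \<le> M $ i $ l + M $ k $ j"
      using P 1[of i j] 1[of i l] 1[of k j] 2[of i j] 2[of i l] 2[of k j]
      by (cases "below h i j") (auto simp: M)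
  qed
qed

section \<open>Clamping\<close>

definition lo :: "('a::finite + 'b::finite \<Rightarrow> real) \<Rightarrow> real" where
  "lo z = max (Min (range (\<lambda>i. z (Inl i)))) (Min (range (\<lambda>j. z (Inr j))))"

text \<open>This is \<open>min (max x) (max y)\<close>, and it may be smaller than \<open>lo z\<close>, in which case \<open>clamp z\<close> is constant.\<close>

definition hi :: "('a::finite + 'b::finite \<Rightarrow> real) \<Rightarrow> real" where
  "hi z = - lo (- z)"

definition clamp :: "('a::finite + 'b::finite \<Rightarrow> real) \<Rightarrow> 'a + 'b \<Rightarrow> real" where
  "clamp z s = max (lo z) (min (hi z) (z s))"

lemma hi_uminus: "hi (- z) = - lo z" and lo_uminus: "lo (- z) = - hi z"
  by (simp_all add: hi_def)

lemma clamp_uminus: "lo z \<le> hi z \<Longrightarrow> clamp (- z) s = - clamp z s"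
  by (auto simp: clamp_def hi_uminus lo_uminus)

text \<open>\<open>lo z\<close> is at least the minimum of either sign, so both signs reach the
  lower end after clamping.\<close>

lemma ex_le_lo:
  obtains t where "\<not> opp s t" "z t \<le> lo z"
proof (cases s)
  case (Inl i)
  obtain k where "z (Inl k) = Min (range (\<lambda>i. z (Inl i)))"
    using Min_in[of "range (\<lambda>i. z (Inl i))"] by fastforce
  then show ?thesis using that[of "Inl k"] Inl by (simp add: lo_def)
next
  case (Inr j)
  obtain k where "z (Inr k) = Min (range (\<lambda>i. z (Inr i)))"
    using Min_in[of "range (\<lambda>i. z (Inr i))"] by fastforce
  then show ?thesis using that[of "Inr k"] Inr by (simp add: lo_def)
qed

text \<open>Only the sign with the smaller minimum can go below \<open>lo z\<close>; the minimum of
  the other sign is then \<open>lo z\<close> itself.\<close>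

lemma lo_le_opp:
  assumes "z t < lo z" "opp s t"
  shows "lo z \<le> z s"
proof -
  define p q where "p = Min (range (\<lambda>i. z (Inl i)))" and "q = Min (range (\<lambda>j. z (Inr j)))"
  have "p \<le> z (Inl i)" "q \<le> z (Inr j)" for i j
    unfolding p_def q_def by (auto intro: Min_le)
  from this(1)[of "projl s"] this(1)[of "projl t"] this(2)[of "projr s"] this(2)[of "projr t"]
  show ?thesis
    using assms unfolding lo_def p_def[symmetric] q_def[symmetric]
    by (cases s; cases t) (auto simp: max_def split: if_splits)
qed

lemma ex_ge_hi:
  obtains t where "\<not> opp s t" "hi z \<le> z t"
  using ex_le_lo[of s "- z"] by (metis hi_def minus_le_iff uminus_apply)

lemma opp_le_hi: "hi z < z t \<Longrightarrow> opp s t \<Longrightarrow> z s \<le> hi z"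
  using lo_le_opp[of "- z" t s] by (simp add: hi_def)

lemma clamp_mono: "z s \<le> z t \<Longrightarrow> clamp z s \<le> clamp z t"
  by (auto simp: clamp_def)

text \<open>Of two opposite letters at most one lies below \<open>lo z\<close>. Its deficit is
  exactly what the minimum loses and depends on a single index, so it moves into \<open>u\<close> or
  \<open>v\<close>. A letter above \<open>hi z\<close> has all opposite letters at or below
  \<open>hi z\<close>, so lowering it to \<open>hi z\<close> changes no minimum.\<close>

lemma represents_clamp:
  assumes "represents z M"
  shows "represents (clamp z) M"
proof -
  obtain u v where M: "\<And>i j. M $ i $ j = u i + v j + min (z (Inl i)) (z (Inr j))"
    using assms by (auto simp: represents_def)
  have "min (z (Inl i)) (z (Inr j)) = min (clamp z (Inl i)) (clamp z (Inr j))
      + (min (z (Inl i)) (lo z) - lo z) + (min (z (Inr j)) (lo z) - lo z)" for i j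
    using lo_le_opp[of z "Inl i" "Inr j"] lo_le_opp[of z "Inr j" "Inl i"]
      opp_le_hi[of z "Inl i" "Inr j"] opp_le_hi[of z "Inr j" "Inl i"]
    by (simp add: clamp_def) argo
  then have "M $ i $ j = (u i + (min (z (Inl i)) (lo z) - lo z)) + (v j + (min (z (Inr j)) (lo z) - lo z))
     + min (clamp z (Inl i)) (clamp z (Inr j))" for i j
    by (simp add: M)
  then show ?thesis unfolding represents_def by (intro exI allI)
qed

section \<open>Uniqueness of clamped representations\<close>

text \<open>If \<open>y (Inl i) < y (Inr j)\<close>, the minor on rows \<open>i\<close>,
  \<open>i1\<close> and columns \<open>j\<close>, \<open>j0\<close> satisfies a strict inequality.
  Were \<open>below h\<close> equal at \<open>(i, j)\<close> and \<open>(i1, j0)\<close>, it would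
  have the same value at a third corner, since comparing heights never produces a permutation
  pattern, and the cone would demand the reverse inequality. So all these pairs get the value
  opposite to that at \<open>(i1, j0)\<close>: this one value is the choice between an order and its
  reversal.\<close>

lemma clamp_order_determined:
  fixes h :: "'m::finite + 'n::finite \<Rightarrow> real"
  assumes "proper h" "M \<in> cone_at h" "represents z M" "lo z < hi z"
  shows "(\<forall>s t. opp s t \<and> clamp z s < clamp z t \<longrightarrow> h s < h t) \<or>
         (\<forall>s t. opp s t \<and> clamp z s < clamp z t \<longrightarrow> h t < h s)"
proof -
  define y where "y = clamp z"
  have ylo: "lo z \<le> y s" and yhi: "y s \<le> hi z" for s
    using assms(4) by (auto simp: y_def clamp_def)
  have yl: "z s \<le> lo z \<Longrightarrow> y s = lo z" and yh: "hi z \<le> z s \<Longrightarrow> y s = hi z" for s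
    using assms(4) by (auto simp: y_def clamp_def)
  obtain i0 where i0: "y (Inl i0) = lo z"
    using ex_le_lo[of "Inl undefined" z] yl by (metis obj_sumE opp_simps(1))
  obtain j0 where j0: "y (Inr j0) = lo z"
    using ex_le_lo[of "Inr undefined" z] yl by (metis obj_sumE opp_simps(2))
  obtain i1 where i1: "y (Inl i1) = hi z"
    using ex_ge_hi[of "Inl undefined" z] yh by (metis obj_sumE opp_simps(1))
  obtain j1 where j1: "y (Inr j1) = hi z"
    using ex_ge_hi[of "Inr undefined" z] yh by (metis obj_sumE opp_simps(2))
  obtain u v where M: "\<And>i j. M $ i $ j = u i + v j + min (y (Inl i)) (y (Inr j))"
    using represents_clamp[OF assms(3)] by (auto simp: represents_def y_def)
  have C: "below h i j = below h i l \<Longrightarrow> below h i j = below h k j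
    \<Longrightarrow> M $ i $ j + M $ k $ l \<le> M $ i $ l + M $ k $ j" for i k j l
    using assms(2) unfolding cone_of_def by blast
  have ferrers: "\<not> (below h i j \<and> below h k l \<and> \<not> below h i l \<and> \<not> below h k j)" for i j k l
    by (auto simp: below_def)
  have up: "below h i j \<noteq> below h i1 j0" if "y (Inl i) < y (Inr j)" for i j
  proof
    assume eq: "below h i j = below h i1 j0"
    have "M $ i $ j + M $ i1 $ j0 < M $ i $ j0 + M $ i1 $ j"
      using that ylo[of "Inl i"] yhi[of "Inr j"] assms(4) by (simp add: M i1 j0)
    then show False
      using C[of i j j0 i1] C[of i1 j0 j i] C[of i j0 j i1] C[of i1 j j0 i] eq
        ferrers[of i j i1 j0] ferrers[of i j0 i1 j] by linarith
  qed
  have down: "below h i j \<noteq> below h i0 j1" if "y (Inr j) < y (Inl i)" for i j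
  proof
    assume eq: "below h i j = below h i0 j1"
    have "M $ i $ j + M $ i0 $ j1 < M $ i $ j1 + M $ i0 $ j"
      using that yhi[of "Inl i"] ylo[of "Inr j"] assms(4) by (simp add: M i0 j1)
    then show False
      using C[of i j j1 i0] C[of i0 j1 j i] C[of i j1 j i0] C[of i0 j j1 i] eq
        ferrers[of i j i0 j1] ferrers[of i j1 i0 j] by linarith
  qed
  \<comment> \<open>\<open>i0\<close> and \<open>j1\<close> are themselves strictly ordered, which
    links the reference values used in \<open>up\<close> and in \<open>down\<close>.\<close>
  have ne: "below h i0 j1 \<noteq> below h i1 j0" using up[of i0 j1] assms(4) i0 j1 by simp
  have P: "h (Inr j) < h (Inl i) \<longleftrightarrow> \<not> below h i j" for i j
    using assms(1) by (auto simp: below_def proper_def not_less less_le)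
  show ?thesis
  proof (cases "below h i0 j1")
    case True
    have "h s < h t" if "opp s t" "y s < y t" for s t
      using that up down ne True P by (cases s; cases t) (auto simp: below_def)
    then show ?thesis by (simp add: y_def)
  next
    case False
    have "h t < h s" if "opp s t" "y s < y t" for s t
      using that up down ne False P by (cases s; cases t) (auto simp: below_def)
    then show ?thesis by (simp add: y_def)
  qed
qed

section \<open>Intersections of cells\<close>

lemma is_singletonD: "is_singleton A \<Longrightarrow> x \<in> A \<Longrightarrow> y \<in> A \<Longrightarrow> x = y"
  by (auto simp: is_singleton_def)

text \<open>The lowest letter opposite to \<open>s\<close> lies in it, because a letter of the sign
  of \<open>s\<close> outside \<open>bottom k\<close> has some opposite letter below it.\<close>

lemma second_nonempty:
  fixes k :: "'a::finite + 'b::finite \<Rightarrow> real"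
  assumes "bottom k = {s}" "opp s t" "proper k"
  shows "\<exists>v\<in>second k. opp s v"
proof -
  obtain v where v: "opp s v" "\<And>w. opp s w \<Longrightarrow> k v \<le> k w"
    using ex_min_if_finite[of "k ` {t. opp s t}"] assms(2) by (auto simp: not_less)
  have "v \<notin> bottom k" using v(1) assms(1) by (auto simp: opp_def)
  moreover have "k v < k q" if q: "opp v q" "q \<notin> bottom k" for q
  proof -
    obtain w where "opp q w" "\<not> k q < k w" using q(2) by (auto simp: bottom_def)
    then have "k w < k q" using assms(3) unfolding proper_def by (metis linorder_neq_iff)
    moreover have "opp s w" using \<open>opp q w\<close> q(1) v(1) by (auto simp: opp_def)
    ultimately show ?thesis using v(2)[of w] by simp
  qed
  ultimately show ?thesis using v(1) by (auto simp: second_def)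
qed

lemma second_opp:
  assumes "bottom k = {s}" "v \<in> second k" "proper k"
  shows "opp s v"
proof (rule ccontr)
  assume "\<not> opp s v"
  then have "k v < k q" if "opp v q" for q
    using assms that unfolding second_def by (auto simp: opp_def)
  then have "v \<in> bottom k" by (auto simp: bottom_def)
  then show False using assms(2) by (simp add: second_def)
qed

text \<open>The only pairs on which the orders of two cells may disagree at a common point without \<open>zc\<close> being
  tight there are those made equal by clamping. For such a pair \<open>s\<close>, \<open>t\<close> at the lower end, \<open>t\<close> is the
  bottom letter of \<open>h\<close>, and clamping \<open>za\<close> repairs the order provided that \<open>s\<close> is minimal among the letters
  of its sign.\<close>

lemma minimal_in_face:
  fixes h k :: "'a::finite + 'b::finite \<Rightarrow> real"
  assumes ph: "proper h" and pk: "proper k"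
    and sizes: "large h \<and> large k \<and> CARD('a + 'b) \<noteq> 4 \<or> small h \<and> small k"
    and zc: "compatible h zc" and za: "compatible h za"
    and tight: "\<And>s t. opp s t \<Longrightarrow> zc s = zc t \<Longrightarrow> za s = za t"
    and order: "\<And>s t. opp s t \<Longrightarrow> k s < k t \<Longrightarrow> clamp zc s \<le> clamp zc t"
    and lohi: "lo zc < hi zc"
    and st: "opp s t" "h t < h s" "k s < k t" "zc t < zc s" "zc s \<le> lo zc"
    and sl: "\<not> opp s l"
  shows "za s \<le> za l"
proof (rule ccontr)
  assume "\<not> za s \<le> za l"
  then have less: "za l < za s" by simp
  have ends: "ends h" "ends k" using sizes by (auto simp: large_def small_def)
  have zcD: "zc a \<le> zc b" and zaD: "za a \<le> za b" if "opp a b" "h a < h b" for a b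
    using zc za that by (auto simp: compatible_def)
  have linh: "h a < h b \<or> h b < h a" and link: "k a < k b \<or> k b < k a" if "opp a b" for a b
    using ph pk that by (auto simp: proper_def neq_iff)
  have cmin: "lo zc \<le> zc q" if "\<not> opp s q" for q
    using lo_le_opp[of zc t q] st that by (auto simp: opp_def)
  have zcs: "zc s = lo zc" using cmin[of s] st by (simp add: opp_def)
  have tbot: "h t < h q" if "opp t q" for q
    using linh[OF that] zcD[of q t] cmin[of q] that st by (force simp: opp_def)
  then have tb: "t \<in> bottom h" by (auto simp: bottom_def)
  have bot: "\<exists>q. opp p q \<and> h q < h p" if "p \<noteq> t" for p
  proof -
    have "p \<notin> bottom h" using is_singletonD[OF _ tb] that ends(1) by (auto simp: ends_def)
    then show ?thesis using linh by (auto simp: bottom_def)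
  qed
  \<comment> \<open>\<open>s\<close> and \<open>l\<close> lie in one block of \<open>h\<close>: an
    opposite letter between them would give \<open>za s \<le> za l\<close>, either by the order or
    by a tie at \<open>zc\<close>.\<close>
  have same_column: "h p < h s \<longleftrightarrow> h p < h l" if p: "opp s p" for p
  proof -
    have lp: "opp l p" "opp p l" "opp p s" using p sl by (auto simp: opp_def)
    have False if "h s < h p" "h p < h l"
      using zaD[of s p] zaD[of p l] that p lp less by simp
    moreover have False if "h l < h p" "h p < h s"
    proof -
      have "zc l = zc p" "zc p = zc s"
        using zcD[of l p] zcD[of p s] that lp cmin[OF sl] zcs by auto
      then show False using tight[of l p] tight[of p s] lp less by simp
    qed
    ultimately show ?thesis using linh lp p by blast
  qed
  \<comment> \<open>Otherwise \<open>zc p\<close> is squeezed between some \<open>zc q\<close> and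
    \<open>zc s\<close>, hence equals \<open>lo zc\<close>, and tightness ties \<open>za p\<close>
    to \<open>za s\<close>.\<close>
  have above: "h s < h p" if p: "opp s p" "p \<noteq> t" for p
  proof (rule ccontr)
    assume "\<not> h s < h p"
    then have ps: "h p < h s" using linh p(1) by blast
    obtain q where q: "opp p q" "h q < h p" using bot p(2) by blast
    have o: "opp p s" "opp p l" "\<not> opp s q" using p(1) q(1) sl by (auto simp: opp_def)
    have "zc p = zc s"
      using zcD[of q p] zcD[of p s] cmin[of q] ps q o zcs by (simp add: opp_sym)
    then have "za p = za s" using tight o by blast
    moreover have "za p \<le> za l" using zaD[of p l] o ps same_column p(1) by blast
    ultimately show False using less by simp
  qed
  have abovel: "h l < h p" if p: "opp s p" "p \<noteq> t" for p
    using above[OF p] same_column[OF p(1)] linh[of p l] p(1) sl by (auto simp: opp_def)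
  have "\<not> k p < k s" if p: "opp s p" for p
  proof
    assume kp: "k p < k s"
    then have "p \<noteq> t" using st by auto
    then have "zc s \<le> zc p" "zc l \<le> zc p" using above abovel zcD p sl by (auto simp: opp_def)
    moreover have "clamp zc p \<le> clamp zc s" using order[of p s] kp p opp_sym by blast
    then have "zc p \<le> lo zc" using zcs lohi by (auto simp: clamp_def)
    ultimately have "zc p = zc s" "zc p = zc l" using zcs cmin[OF sl] by auto
    then show False using tight[of p s] tight[of p l] p sl less by (auto simp: opp_def)
  qed
  then have "s \<in> bottom k" using link by (auto simp: bottom_def)
  then have ks: "bottom k = {s}" using ends(2) by (auto simp: ends_def is_singleton_def)
  have ht: "bottom h = {t}" using ends(1) tb by (auto simp: ends_def is_singleton_def)
  \<comment> \<open>This settles small cells. From here on the cells are large, and the rest counts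
    letters.\<close>
  have "s \<in> second h" "l \<in> second h"
    using above abovel ht st(1) sl by (auto simp: second_def opp_def)
  then have "\<not> is_singleton (second h)" using less by (auto simp: is_singleton_def)
  then have large: "large k" and N: "CARD('a + 'b) \<noteq> 4" using sizes by (auto simp: small_def)
  obtain p where p: "p \<in> second k" "p \<noteq> t"
    using second_nonempty[OF ks st(1) pk] large by (auto simp: large_def is_singleton_def)
  \<comment> \<open>\<open>p\<close> and \<open>l\<close> agree after clamping but not before, so
    both lie at or beyond the upper end, and \<open>p\<close> is the top letter of
    \<open>h\<close>.\<close>
  have key: "p \<in> bottom (- h) \<and> hi zc \<le> zc l \<and> (\<forall>r. opp r p \<longrightarrow> zc r \<le> hi zc)"
    if p: "p \<in> second k" "p \<noteq> t" for p
  proof -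
    have sp: "opp s p" using second_opp[OF ks p(1) pk] .
    have lp: "opp l p" "opp p l" using sp sl by (auto simp: opp_def)
    have "k p < k l" using p(1) ks less lp by (auto simp: second_def)
    then have "clamp zc p \<le> clamp zc l" using order lp by blast
    moreover have le: "zc l \<le> zc p" using zcD abovel[OF sp p(2)] lp by blast
    ultimately have eq: "clamp zc p = clamp zc l" using clamp_mono by (metis order_antisym)
    have "zc p \<noteq> zc l"
      using tight[of p l] lp zaD[of s p] above sp p(2) less by force
    then have "zc l < zc p" using le by simp
    then have hp: "hi zc \<le> zc l" "hi zc < zc p"
      using eq lohi cmin[OF sl] by (auto simp: clamp_def max_def min_def split: if_splits)
    have m: "zc r \<le> hi zc" if "opp r p" for r
      using opp_le_hi hp(2) that by blast
    have "h q < h p" if "opp p q" for q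
      using linh[OF that] zcD[OF that] m[of q] hp(2) that opp_sym by force
    then show ?thesis using hp m by (auto simp: bottom_def)
  qed
  have topp: "bottom (- h) = {p}"
    using key[OF p] ends(1) by (auto simp: ends_def is_singleton_def)
  have sp: "opp s p" using second_opp[OF ks p(1) pk] .
  \<comment> \<open>A further letter \<open>r\<close> would have \<open>zc r\<close> squeezed
    between \<open>zc l\<close> and \<open>hi zc\<close>, producing a tie with \<open>l\<close> that
    tightness forbids.\<close>
  have two: "r = t \<or> r = p" if r: "opp s r" for r
  proof (rule ccontr)
    assume n: "\<not> (r = t \<or> r = p)"
    then have "r \<notin> bottom (- h)" using topp by simp
    then obtain q where q: "opp r q" "h r < h q" using linh by (force simp: bottom_def)
    have lr: "opp l r" "opp r l" using r sl by (auto simp: opp_def)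
    have "zc l \<le> zc r" using zcD[of l r] abovel r n lr by blast
    moreover have "zc r \<le> zc q" using zcD q by blast
    moreover have "zc q \<le> hi zc" "hi zc \<le> zc l"
      using key[OF p] q(1) r sp by (auto simp: opp_def)
    ultimately have "zc l = zc r" by simp
    then have "za l = za r" using tight lr by blast
    moreover have "za s \<le> za r" using zaD above r n by blast
    ultimately show False using less by simp
  qed
  have sec: "t \<in> second k"
  proof (rule ccontr)
    assume "t \<notin> second k"
    then have "second k \<subseteq> {p}" using two second_opp[OF ks _ pk] by blast
    then show False using p(1) large by (auto simp: large_def is_singleton_def)
  qed
  \<comment> \<open>The second block of \<open>k\<close> contains both opposite letters, so every
    letter of the sign of \<open>s\<close> except \<open>s\<close> is above them and belongs to the
    singleton top block.\<close>
  have only: "r = l" if r: "\<not> opp s r" "r \<noteq> s" for r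
  proof -
    have "v \<in> bottom (- k)" if v: "\<not> opp s v" "v \<noteq> s" for v
    proof -
      have "k q < k v" if "opp v q" for q
      proof -
        have "opp s q" using that v by (auto simp: opp_def)
        then have "q \<in> second k" using two sec p(1) by blast
        then show ?thesis using that v ks by (auto simp: second_def opp_sym)
      qed
      then show ?thesis by (auto simp: bottom_def)
    qed
    then show ?thesis using is_singletonD[of "bottom (- k)" r l] r sl less ends(2)
      by (auto simp: ends_def)
  qed
  have "UNIV = {s, l, t, p}" using only two by auto
  moreover have "s \<noteq> l" "s \<noteq> t" "s \<noteq> p" "l \<noteq> t" "l \<noteq> p" "t \<noteq> p"
    using less st p sp sl by (auto simp: opp_def)
  ultimately have "CARD('a + 'b) = card {s, l, t, p}" by simp
  also have "\<dots> = 4" using \<open>s \<noteq> l\<close> \<open>s \<noteq> t\<close> \<open>s \<noteq> p\<close> \<open>l \<noteq> t\<close> \<open>l \<noteq> p\<close> \<open>t \<noteq> p\<close> by simp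
  finally show False using N by simp
qed

section \<open>Large cells of matrices with two rows or two columns\<close>

lemma card_opp:
  "card {t :: 'a::finite + 'b::finite. opp s t} = (if isl s then CARD('b) else CARD('a))"
proof (cases s)
  case (Inl i)
  have "{t :: 'a + 'b. opp s t} = range Inr" using Inl by (auto simp: opp_def) (metis obj_sumE rangeI isl_def)
  then show ?thesis using Inl by (simp add: card_image)
next
  case (Inr i)
  have "{t :: 'a + 'b. opp s t} = range Inl" using Inr by (auto simp: opp_def) (metis obj_sumE rangeI sum.disc(2))
  then show ?thesis using Inr by (simp add: card_image)
qed

text \<open>\<open>v\<close> separates \<open>u\<close> from \<open>t\<close>, so with these as the
  only letters opposite to \<open>s\<close> the second block is just \<open>{u}\<close>.\<close>

lemma two_opp_not_large:
  fixes h :: "'a::finite + 'b::finite \<Rightarrow> real"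
  assumes "proper h" "large h" and opp: "{r. opp s r} = {t, u}"
    and ord: "h s < h t" "h s < h u" "h v < h t" "h u < h v" and sv: "\<not> opp s v"
  shows False
proof -
  have "h s < h r" if "opp s r" for r
    using opp ord that by (metis insertE mem_Collect_eq singletonD)
  then have "s \<in> bottom h" by (auto simp: bottom_def)
  then have b: "bottom h = {s}" using assms(2) by (auto simp: large_def ends_def is_singleton_def)
  have st: "opp s t" using opp by auto
  obtain w where "w \<in> second h" using second_nonempty[OF b st assms(1)] by auto
  moreover have "second h \<subseteq> {t, u}" using second_opp[OF b _ assms(1)] opp by blast
  moreover have "second h \<noteq> {u}" using assms(2) by (auto simp: large_def is_singleton_def)
  ultimately have "t \<in> second h" by blast
  moreover have "opp t v" "v \<noteq> s" using st sv ord by (auto simp: opp_def)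
  ultimately have "h t < h v" using b by (auto simp: second_def)
  then show False using ord by simp
qed

text \<open>A nontrivial inequality needs one value of the pattern at three corners of a minor. If
  the fourth corner has it too, two letters share an extreme block; if not, the four letters
  alternate and make the block next to an end a singleton. A large label allows neither.\<close>

lemma large_cone_two:
  fixes h :: "'m::finite + 'n::finite \<Rightarrow> real"
  assumes "proper h" "large h" "CARD('m) = 2 \<or> CARD('n) = 2"
  shows "cone_at h = UNIV"
proof -
  have no: False
    if h: "proper h" "large h" and P: "below h i j" "below h i l" "below h k j" and ne: "i \<noteq> k" "j \<noteq> l"
    for h :: "'m + 'n \<Rightarrow> real" and i k j l
    using assms(3)
  proof
    assume m: "CARD('m) = 2"
    have U: "{r. opp (Inr j) r} = {Inl i, Inl k}"
      by (rule card_seteq[symmetric]) (use ne m in \<open>auto simp: card_opp\<close>)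
    have kl: "h (Inr l) < h (Inl k)"
    proof (rule ccontr)
      assume "\<not> ?thesis"
      then have "below h k l" using h(1) unfolding proper_def below_def by (metis linorder_neq_iff opp_simps(1))
      moreover have "r = Inl i \<or> r = Inl k" if "opp (Inr q) r" for q :: 'n and r
      proof -
        have "r \<in> {r. opp (Inr j) r}" using that by (simp add: opp_def)
        then show ?thesis unfolding U by blast
      qed
      ultimately have "Inr j \<in> bottom (- h)" "Inr l \<in> bottom (- h)"
        using P unfolding bottom_def below_def by fastforce+
      then show False using h(2) ne by (auto simp: large_def ends_def is_singleton_def)
    qed
    show False
      using two_opp_not_large[of "- h" "Inr j" "Inl i" "Inl k" "Inr l"] h U P kl
      by (simp add: below_def)
  next
    assume n: "CARD('n) = 2"
    have U: "{r. opp (Inl i) r} = {Inr j, Inr l}"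
      by (rule card_seteq[symmetric]) (use ne n in \<open>auto simp: card_opp\<close>)
    have kl: "h (Inr l) < h (Inl k)"
    proof (rule ccontr)
      assume "\<not> ?thesis"
      then have "below h k l" using h(1) unfolding proper_def below_def by (metis linorder_neq_iff opp_simps(1))
      moreover have "r = Inr j \<or> r = Inr l" if "opp (Inl q) r" for q :: 'm and r
      proof -
        have "r \<in> {r. opp (Inl i) r}" using that by (simp add: opp_def)
        then show ?thesis unfolding U by blast
      qed
      ultimately have "Inl i \<in> bottom h" "Inl k \<in> bottom h"
        using P unfolding bottom_def below_def by fastforce+
      then show False using h(2) ne by (auto simp: large_def ends_def is_singleton_def)
    qed
    show False
      using two_opp_not_large[of h "Inl i" "Inr j" "Inr l" "Inl k"] h U P kl
      by (simp add: below_def)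
  qed
  have eq: "i = k \<or> j = l" if "below h i j = below h i l" "below h i j = below h k j" for i j k l
  proof (rule ccontr)
    assume "\<not> (i = k \<or> j = l)"
    then have ne: "i \<noteq> k" "j \<noteq> l" by auto
    show False
    proof (cases "below h i j")
      case True
      then show ?thesis using no[OF assms(1,2), of i j l k] that ne by simp
    next
      case False
      then show ?thesis using no[of "- h" i j l k] that ne assms(1,2) by (simp add: below_uminus)
    qed
  qed
  have "M \<in> cone_at h" for M
    unfolding cone_of_def
  proof (intro CollectI allI impI)
    fix i k j l assume "below h i j = below h i l \<and> below h i j = below h k j"
    then show "M $ i $ j + M $ k $ l \<le> M $ i $ l + M $ k $ j"
      using eq[of i j l k] by auto
  qed
  then show ?thesis by blast
qed

section \<open>Points where clamping loses the order\<close>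

lemma sum_mem_cone_of:
  assumes "\<And>i j. M $ i $ j = u i + v j"
  shows "M \<in> cone_of P"
  using assms by (simp add: cone_of_def)

lemma represents_const_mem_cone:
  assumes "represents z M" "\<forall>q r. \<not> opp s q \<and> \<not> opp s r \<longrightarrow> z q = z r"
  shows "M \<in> cone_of P"
proof -
  obtain u v where M: "\<And>i j. M $ i $ j = u i + v j + min (z (Inl i)) (z (Inr j))"
    using assms(1) by (auto simp: represents_def)
  show ?thesis
  proof (cases s)
    case (Inl i)
    then have c: "z (Inl k) = z (Inl i)" for k using assms(2) by auto
    show ?thesis
      by (intro sum_mem_cone_of[where u = u and v = "\<lambda>j. v j + min (z (Inl i)) (z (Inr j))"]) (subst M, subst c, simp)
  next
    case (Inr j)
    then have c: "z (Inr k) = z (Inr j)" for k using assms(2) by auto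
    show ?thesis
      by (intro sum_mem_cone_of[where u = "\<lambda>i. u i + min (z (Inl i)) (z (Inr j))" and v = v]) (subst M, subst c, simp)
  qed
qed

lemma represents_sorted_mem_cone:
  assumes "represents z M" "\<forall>q r. \<not> opp s q \<and> opp s r \<longrightarrow> z q \<le> z r"
  shows "M \<in> cone_of P"
proof -
  obtain u v where M: "\<And>i j. M $ i $ j = u i + v j + min (z (Inl i)) (z (Inr j))"
    using assms(1) by (auto simp: represents_def)
  show ?thesis
  proof (cases s)
    case (Inl i)
    then have "z (Inl k) \<le> z (Inr j)" for k j using assms(2) by auto
    then show ?thesis
      by (intro sum_mem_cone_of[where u = "\<lambda>i. u i + z (Inl i)" and v = v]) (simp add: M)
  next
    case (Inr j)
    then have "z (Inr k) \<le> z (Inl i)" for k i using assms(2) by auto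
    then show ?thesis
      by (intro sum_mem_cone_of[where u = u and v = "\<lambda>j. v j + z (Inr j)"]) (simp add: M min_absorb2)
  qed
qed

text \<open>For \<open>hi zc \<le> lo zc\<close> the order of the clamped coordinates carries no information, but the face of
  \<open>cone_at h\<close> through such a point consists of sums \<open>u i + v j\<close>, which lie in every cone.\<close>

lemma mem_cone_of_degenerate:
  fixes h :: "'m::finite + 'n::finite \<Rightarrow> real" and M :: "real^'n^'m"
  assumes ph: "proper h" and card: "CARD('m) \<ge> 2" "CARD('n) \<ge> 2"
    and sizes: "large h \<and> CARD('m) \<noteq> 2 \<and> CARD('n) \<noteq> 2 \<or> small h"
    and zc: "compatible h zc" and za: "compatible h za"
    and tight: "\<And>s t. opp s t \<Longrightarrow> zc s = zc t \<Longrightarrow> za s = za t"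
    and M: "represents za M" and hilo: "hi zc \<le> lo zc"
  shows "M \<in> cone_of P"
proof -
  have linh: "h a < h b \<or> h b < h a" if "opp a b" for a b
    using ph that by (auto simp: proper_def neq_iff)
  have zcD: "zc a \<le> zc b" and zaD: "za a \<le> za b" if "opp a b" "h a < h b" for a b
    using zc za that by (auto simp: compatible_def)
  \<comment> \<open>At most one sign goes below \<open>lo zc\<close>, and \<open>s\<close> is taken
    from the other one; \<open>s'\<close> arises in the same way at the upper end.\<close>
  obtain s where s: "\<And>q. \<not> opp s q \<Longrightarrow> lo zc \<le> zc q"
  proof (cases "\<exists>t. zc t < lo zc")
    case True
    then obtain t where t: "zc t < lo zc" ..
    obtain s where "opp s t" by (metis sum.exhaust opp_simps(1,2))
    then show ?thesis using that[of s] lo_le_opp[OF t] by (auto simp: opp_def)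
  qed (auto intro: that simp: not_less)
  obtain s' where s': "\<And>q. \<not> opp s' q \<Longrightarrow> zc q \<le> hi zc"
  proof (cases "\<exists>t. hi zc < zc t")
    case True
    then obtain t where t: "hi zc < zc t" ..
    obtain s where "opp s t" by (metis sum.exhaust opp_simps(1,2))
    then show ?thesis using that[of s] opp_le_hi[OF t] by (auto simp: opp_def)
  qed (auto intro: that simp: not_less)
  show ?thesis
  proof (cases "opp s' s")
    case True
    have "za q \<le> za r" if "\<not> opp s' q" "opp s' r" for q r
    proof -
      have qr: "opp q r" using that by (auto simp: opp_def)
      have "zc q \<le> zc r" using s[of r] s'[of q] that True hilo by (auto simp: opp_def)
      then show ?thesis
        using linh[OF qr] zaD[OF qr] zcD[OF opp_sym[OF qr]] tight[OF qr] by linarith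
    qed
    then show ?thesis using represents_sorted_mem_cone[OF M] by blast
  next
    case False
    have v: "zc q = lo zc" if "\<not> opp s q" for q
      using s[of q] s'[of q] that False hilo by (auto simp: opp_def)
    show ?thesis
    proof (cases "\<exists>r. opp s r \<and> zc r = lo zc")
      case True
      then obtain r where r: "opp s r" "zc r = lo zc" by blast
      have "za q = za r" if "\<not> opp s q" for q
        using tight[of q r] v[OF that] r that by (auto simp: opp_def)
      then show ?thesis using represents_const_mem_cone[OF M, of s] by metis
    next
      \<comment> \<open>Each letter opposite to \<open>s\<close> now lies strictly to one side of
        all letters of the sign of \<open>s\<close>, so it is the bottom or the top letter of
        \<open>h\<close>, and there are exactly two of them. By \<open>sizes\<close> the label is
        small; yet all letters of the sign of \<open>s\<close> would lie in its second
        block.\<close>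
      case none: False
      have ends: "ends h" using sizes by (auto simp: large_def small_def)
      then obtain b t where bt: "bottom h = {b}" "bottom (- h) = {t}"
        by (auto simp: ends_def is_singleton_def)
      have or: "(r = b \<and> (\<forall>q. opp r q \<longrightarrow> h r < h q)) \<or> (r = t \<and> (\<forall>q. opp r q \<longrightarrow> h q < h r))"
        if r: "opp s r" for r
      proof -
        consider "zc r < lo zc" | "lo zc < zc r" using none r by force
        then show ?thesis
        proof cases
          case 1
          have "h r < h q" if rq: "opp r q" for q
            using linh[OF rq] zcD[of q r] v[of q] 1 r rq by (auto simp: opp_def)
          moreover then have "r \<in> bottom h" by (auto simp: bottom_def)
          ultimately show ?thesis using bt by auto
        next
          case 2
          have "h q < h r" if rq: "opp r q" for q
            using linh[OF rq] zcD[of r q] v[of q] 2 r rq by (auto simp: opp_def)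
          moreover then have "r \<in> bottom (- h)" by (auto simp: bottom_def)
          ultimately show ?thesis using bt by auto
        qed
      qed
      then have sub: "{r. opp s r} \<subseteq> {b, t}" by auto
      have c2: "2 \<le> card {r. opp s r}" using card by (simp add: card_opp)
      have "card {r. opp s r} \<le> card {b, t}" by (rule card_mono) (use sub in auto)
      also have "\<dots> \<le> 2" by (simp add: card_insert_if)
      finally have "card {r. opp s r} = 2" using c2 by simp
      then have small: "small h" using sizes by (auto simp: card_opp split: if_splits)
      have eq: "{r. opp s r} = {b, t}"
        by (rule card_seteq) (use sub c2 in \<open>auto simp: card_insert_if\<close>)
      then have ob: "opp s b" "opp s t" by auto
      have "b \<noteq> t" using c2 eq by auto
      then have tq: "h q < h t" if "opp t q" for q using or[OF ob(2)] that by auto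
      have "\<not> opp s q \<Longrightarrow> q \<in> second h" for q
        using ob eq bt tq by (auto simp: second_def opp_def)
      then have "{q. opp b q} \<subseteq> second h" using ob by (auto simp: opp_def)
      moreover obtain x where "second h = {x}" using small by (auto simp: small_def is_singleton_def)
      ultimately have "card {q. opp b q} \<le> card {x}" by (intro card_mono) auto
      then show ?thesis using card by (simp add: card_opp split: if_splits)
    qed
  qed
qed

text \<open>\<open>h\<close> decides every minimum, so coordinates of \<open>a\<close> and
  \<open>b\<close> compatible with \<open>h\<close> interpolate to coordinates of \<open>c\<close>,
  and ties at \<open>c\<close> are ties at \<open>a\<close>. What \<open>k\<close> says about
  clamped \<open>zc\<close> is to be transferred to clamped \<open>za\<close>; the pairs that
  neither \<open>h\<close> nor a tie settles are left to \<open>minimal_in_face\<close>.\<close>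

lemma open_segment_mem_cone:
  fixes h k :: "'m::finite + 'n::finite \<Rightarrow> real" and a b c :: "real^'n^'m"
  assumes ph: "proper h" and pk: "proper k" and card: "CARD('m) \<ge> 2" "CARD('n) \<ge> 2"
    and sizes: "large h \<and> large k \<or> small h \<and> small k"
    and a: "a \<in> cone_at h" and b: "b \<in> cone_at h" and c: "c \<in> open_segment a b" "c \<in> cone_at k"
  shows "a \<in> cone_at k"
proof (cases "large k \<and> (CARD('m) = 2 \<or> CARD('n) = 2)")
  case True
  then show ?thesis using large_cone_two pk by auto
next
  case False
  then have sizes': "large h \<and> large k \<and> CARD('m) \<noteq> 2 \<and> CARD('n) \<noteq> 2 \<or> small h \<and> small k"
    using sizes by auto
  have sizes4: "large h \<and> large k \<and> CARD('m + 'n) \<noteq> 4 \<or> small h \<and> small k"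
    using sizes' card by auto
  obtain e where e: "0 < e" "e < 1" and ce: "c = (1 - e) *\<^sub>R a + e *\<^sub>R b"
    using c(1) by (auto simp: in_segment)
  obtain za where za: "compatible h za" "represents za a" using a mem_cone_at_iff[OF ph] by blast
  obtain zb where zb: "compatible h zb" "represents zb b" using b mem_cone_at_iff[OF ph] by blast
  define zc where "zc s = (1 - e) * za s + e * zb s" for s
  have zaD: "za s \<le> za t" and zbD: "zb s \<le> zb t" if "opp s t" "h s < h t" for s t
    using za zb that by (auto simp: compatible_def)
  have zc: "compatible h zc"
    unfolding compatible_def zc_def using zaD zbD e by (auto intro!: add_mono mult_left_mono)
  have linh: "h s < h t \<or> h t < h s" if "opp s t" for s t
    using ph that by (auto simp: proper_def neq_iff)
  have tight0: "za s = za t" if st: "opp s t" "h s < h t" "zc s = zc t" for s t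
  proof -
    have "(1 - e) * za s \<le> (1 - e) * za t" "e * zb s \<le> e * zb t"
      using zaD zbD st e by (auto intro!: mult_left_mono)
    then have "(1 - e) * za s = (1 - e) * za t" using st(3) unfolding zc_def by linarith
    then show ?thesis using e by simp
  qed
  have tight: "za s = za t" if "opp s t" "zc s = zc t" for s t
    using tight0[OF that(1)] tight0[OF opp_sym[OF that(1)]] linh[OF that(1)] that(2) by auto
  obtain ua va where A: "\<And>i j. a $ i $ j = ua i + va j + min (za (Inl i)) (za (Inr j))"
    using za by (auto simp: represents_def)
  obtain ub vb where B: "\<And>i j. b $ i $ j = ub i + vb j + min (zb (Inl i)) (zb (Inr j))"
    using zb by (auto simp: represents_def)
  have m: "min (zc (Inl i)) (zc (Inr j)) = (1 - e) * min (za (Inl i)) (za (Inr j)) + e * min (zb (Inl i)) (zb (Inr j))"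
    for i j
  proof (cases "h (Inl i) < h (Inr j)")
    case True
    then show ?thesis using zaD[of "Inl i" "Inr j"] zbD[of "Inl i" "Inr j"] zc
      by (simp add: compatible_def zc_def[symmetric])
  next
    case False
    then have "h (Inr j) < h (Inl i)" using linh[of "Inl i" "Inr j"] by simp
    then show ?thesis using zaD[of "Inr j" "Inl i"] zbD[of "Inr j" "Inl i"] zc
      by (simp add: compatible_def zc_def[symmetric] min_absorb2)
  qed
  have "c $ i $ j = ((1 - e) * ua i + e * ub i) + ((1 - e) * va j + e * vb j)
      + min (zc (Inl i)) (zc (Inr j))" for i j
    unfolding m ce by (simp add: A B algebra_simps)
  then have rc: "represents zc c" unfolding represents_def by (intro exI allI)
  show ?thesis
  proof (cases "lo zc < hi zc")
    case False
    then show ?thesis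
      using mem_cone_of_degenerate[OF ph card _ zc za(1) tight za(2)] sizes' by auto
  next
    case True
    \<comment> \<open>Stated for an arbitrary \<open>k\<close>, as it is also applied to
      \<open>- k\<close> when the order comes out reversed.\<close>
    have main: "a \<in> cone_at k"
      if pk: "proper k" and sizes: "large h \<and> large k \<and> CARD('m + 'n) \<noteq> 4 \<or> small h \<and> small k"
        and ord: "\<And>s t. opp s t \<Longrightarrow> clamp zc s < clamp zc t \<Longrightarrow> k s < k t" for k :: "'m + 'n \<Rightarrow> real"
    proof -
      have order: "clamp zc s \<le> clamp zc t" if "opp s t" "k s < k t" for s t
        using ord[OF opp_sym[OF that(1)]] that(2) by (meson not_less order_less_asym)
      have "clamp za s \<le> clamp za t" if st: "opp s t" "k s < k t" for s t
      proof -
        consider "h s < h t" | "h t < h s" "zc s = zc t" | "h t < h s" "zc t < zc s"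
          using linh[OF st(1)] zc opp_sym[OF st(1)] unfolding compatible_def by (metis order_le_less)
        then show ?thesis
        proof cases
          case 1
          then show ?thesis using zaD st clamp_mono by blast
        next
          case 2
          then show ?thesis using tight st by (simp add: clamp_def)
        next
          case 3
          have "clamp zc s = clamp zc t"
            using order[OF st] clamp_mono[of zc t s] 3 by simp
          \<comment> \<open>Strictly ordered values with equal clamps lie beyond the same
            end.\<close>
          then consider "zc s \<le> lo zc" | "hi zc \<le> zc t"
            using 3 True by (auto simp: clamp_def max_def min_def split: if_splits)
          then show ?thesis
          proof cases
            case 1
            obtain l where l: "\<not> opp s l" "za l \<le> lo za" using ex_le_lo[of s za] by blast
            have "za s \<le> za l"
              using minimal_in_face[OF ph pk sizes zc za(1) tight order True st(1) 3(1) st(2) 3(2) 1 l(1)] .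
            then show ?thesis using l(2) by (auto simp: clamp_def)
          next
            case 2
            obtain l where l: "\<not> opp t l" "hi za \<le> za l" using ex_ge_hi[of t za] by blast
            have order': "clamp (- zc) s \<le> clamp (- zc) t" if "opp s t" "(- k) s < (- k) t" for s t
              using order[OF opp_sym[OF that(1)]] that(2) True by (simp add: clamp_uminus)
            have tight': "(- za) s = (- za) t" if "opp s t" "(- zc) s = (- zc) t" for s t
              using tight that by simp
            \<comment> \<open>Negation turns the upper end into the lower one and exchanges the
              roles of \<open>s\<close> and \<open>t\<close>.\<close>
            have "(- za) t \<le> (- za) l"
              using minimal_in_face[where h = "- h" and k = "- k" and zc = "- zc" and za = "- za" and s = t and t = s and l = l]
                ph pk sizes zc za(1) tight' order' True st(1) 3 st(2) 2 l(1) opp_sym[of s t]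
              by (simp add: compatible_uminus lo_uminus hi_uminus)
            then show ?thesis using l(2) by (auto simp: clamp_def)
          qed
        qed
      qed
      then have "compatible k (clamp za)" by (auto simp: compatible_def)
      then show ?thesis using mem_cone_at_iff[OF pk] represents_clamp[OF za(2)] by blast
    qed
    show ?thesis
      using clamp_order_determined[OF pk c(2) rc True]
    proof
      assume "\<forall>s t. opp s t \<and> clamp zc s < clamp zc t \<longrightarrow> k s < k t"
      then show ?thesis using main[OF pk sizes4] by blast
    next
      assume "\<forall>s t. opp s t \<and> clamp zc s < clamp zc t \<longrightarrow> k t < k s"
      then show ?thesis using main[of "- k"] pk sizes4 by (simp add: cone_at_uminus)
    qed
  qed
qed

lemma cone_Int_face:
  fixes h k :: "'m::finite + 'n::finite \<Rightarrow> real"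
  assumes "proper h" "proper k" "CARD('m) \<ge> 2" "CARD('n) \<ge> 2"
    and "large h \<and> large k \<or> small h \<and> small k"
  shows "cone_at h \<inter> cone_at k face_of cone_at h"
  unfolding face_of_def
proof (intro conjI ballI impI)
  show "convex (cone_at h \<inter> cone_at k)"
    by (intro convex_Int polyhedron_imp_convex polyhedron_cone_of)
next
  fix a b c assume abc: "a \<in> cone_at h" "b \<in> cone_at h" "c \<in> cone_at h \<inter> cone_at k" "c \<in> open_segment a b"
  show "a \<in> cone_at h \<inter> cone_at k" "b \<in> cone_at h \<inter> cone_at k"
    using open_segment_mem_cone[OF assms, of a b c] open_segment_mem_cone[OF assms, of b a c] abc
    by (auto simp: open_segment_commute)
qed auto

section \<open>Regions and their cells\<close>

definition coord :: "('m::finite, 'n::finite) params \<Rightarrow> 'm + 'n \<Rightarrow> real" where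
  "coord p = case_sum (x_coord p) (y_coord p)"

definition region_of :: "('m::finite + 'n::finite \<Rightarrow> real) \<Rightarrow> ('m, 'n) params set" where
  "region_of h = {p. \<forall>i j. if below h i j then x_coord p i < y_coord p j else x_coord p i > y_coord p j}"

lemma coord_simps [simp]: "coord p (Inl i) = x_coord p i" "coord p (Inr j) = y_coord p j"
  by (simp_all add: coord_def)

lemma represents_g: "represents (coord p) (g p)"
proof -
  obtain a A b B where p: "p = (a, A, b, B)" by (cases p)
  show ?thesis unfolding represents_def p
    by (intro exI[of _ "\<lambda>i. A $ i"] exI[of _ "\<lambda>j. b $ j"])
       (auto simp: g_def x_coord_def y_coord_def min_def)
qed

lemma represents_imp_ex_g:
  fixes M :: "real^'n::finite^'m::finite"
  assumes "represents z M"
  shows "\<exists>p. g p = M \<and> coord p = z"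
proof -
  obtain u v where M: "\<And>i j. M $ i $ j = u i + v j + min (z (Inl i)) (z (Inr j))"
    using assms by (auto simp: represents_def)
  define p :: "('m, 'n) params" where
    "p = (\<chi> i. u i + z (Inl i), \<chi> i. u i, \<chi> j. v j, \<chi> j. v j + z (Inr j))"
  have "g p = M" by (auto simp: p_def g_def vec_eq_iff M)
  moreover have "coord p = z"
    by (auto simp: fun_eq_iff coord_def p_def x_coord_def y_coord_def split: sum.split)
  ultimately show ?thesis by blast
qed

lemma mem_region_of_iff:
  assumes "proper h"
  shows "p \<in> region_of h \<longleftrightarrow> (\<forall>s t. opp s t \<and> h s < h t \<longrightarrow> coord p s < coord p t)"
proof
  assume p: "p \<in> region_of h"
  show "\<forall>s t. opp s t \<and> h s < h t \<longrightarrow> coord p s < coord p t"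
  proof (intro allI impI)
    fix s t assume "opp s t \<and> h s < h t"
    then show "coord p s < coord p t"
      using p by (cases s; cases t) (auto simp: region_of_def below_def split: if_splits)
  qed
next
  assume R: "\<forall>s t. opp s t \<and> h s < h t \<longrightarrow> coord p s < coord p t"
  have "h (Inl i) < h (Inr j) \<or> h (Inr j) < h (Inl i)" for i j
    using assms unfolding proper_def by (metis linorder_neq_iff opp_simps(1))
  then show "p \<in> region_of h"
    using R[rule_format, of "Inl i" "Inr j" for i j] R[rule_format, of "Inr j" "Inl i" for i j]
    by (auto simp: region_of_def below_def) blast
qed

lemma x_coord_lin: "x_coord (u *\<^sub>R p + v *\<^sub>R q) i = u * x_coord p i + v * x_coord q i"
  by (simp add: x_coord_def case_prod_beta algebra_simps)

lemma y_coord_lin: "y_coord (u *\<^sub>R p + v *\<^sub>R q) j = u * y_coord p j + v * y_coord q j"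
  by (simp add: y_coord_def case_prod_beta algebra_simps)

lemma coord_lin: "coord (u *\<^sub>R p + v *\<^sub>R q) s = u * coord p s + v * coord q s"
  by (cases s) (simp_all add: x_coord_lin y_coord_lin)

lemma coord_surj: "\<exists>p. coord p = (z :: 'm::finite + 'n::finite \<Rightarrow> real)"
proof -
  have "represents z (\<chi> i j. 0 + 0 + min (z (Inl i)) (z (Inr j)))"
    unfolding represents_def by (intro exI[of _ "\<lambda>_. 0"]) simp
  then show ?thesis using represents_imp_ex_g by blast
qed

lemma region_of_nonempty: "proper h \<Longrightarrow> region_of h \<noteq> {}"
  using coord_surj[of h] by (auto simp: mem_region_of_iff)

lemma convex_region_of:
  assumes "proper h"
  shows "convex (region_of h)"
proof (rule convexI)
  fix p q and u v :: real
  assume pq: "p \<in> region_of h" "q \<in> region_of h" and uv: "0 \<le> u" "0 \<le> v" "u + v = 1"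
  show "u *\<^sub>R p + v *\<^sub>R q \<in> region_of h"
    unfolding mem_region_of_iff[OF assms]
  proof (intro allI impI)
    fix s t assume "opp s t \<and> h s < h t"
    then have "coord p s < coord p t" "coord q s < coord q t"
      using pq mem_region_of_iff[OF assms] by auto
    then show "coord (u *\<^sub>R p + v *\<^sub>R q) s < coord (u *\<^sub>R p + v *\<^sub>R q) t"
      unfolding coord_lin using uv convex_bound_lt
      by (metis add_le_less_mono add_less_le_mono add_0 less_eq_real_def mult_left_mono mult_strict_left_mono zero_neq_one)
  qed
qed

lemma continuous_on_coord [continuous_intros]: "continuous_on S (\<lambda>p. coord p s)"
proof (cases s)
  case (Inl i)
  have eq: "(\<lambda>p. coord p s) = (\<lambda>p. fst p $ i - fst (snd p) $ i)"
    by (auto simp: Inl x_coord_def)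
  show ?thesis unfolding eq by (intro continuous_intros)
next
  case (Inr j)
  have eq: "(\<lambda>p. coord p s) = (\<lambda>p. snd (snd (snd p)) $ j - fst (snd (snd p)) $ j)"
    by (auto simp: Inr y_coord_def)
  show ?thesis unfolding eq by (intro continuous_intros)
qed

lemma open_region_of: 
  assumes "proper h"
  shows "open (region_of h)"
proof -
  have "region_of h = (\<Inter>(s, t)\<in>{(s, t). opp s t \<and> h s < h t}. {p. coord p s < coord p t})"
    by (auto simp: mem_region_of_iff[OF assms])
  also have "open \<dots>"
    by (intro open_INT) (auto intro!: open_Collect_less continuous_on_coord)
  finally show ?thesis .
qed

text \<open>Connectedness comes from convexity. For maximality, no difference of coordinates of
  opposite letters can change sign on a connected set that avoids the hyperplanes.\<close>

lemma region_of_mem_regions: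
  fixes h :: "'m::finite + 'n::finite \<Rightarrow> real"
  assumes "proper h"
  shows "region_of h \<in> regions"
  unfolding regions_def in_components_maximal
proof (intro conjI allI impI)
  show "region_of h \<noteq> {}" using region_of_nonempty[OF assms] .
  show "region_of h \<subseteq> - \<Union>arrangement"
  proof (clarsimp simp: arrangement_def)
    fix p :: "('m, 'n) params" and i j
    assume "p \<in> region_of h" "x_coord p i = y_coord p j"
    then show False unfolding region_of_def by (smt (verit) mem_Collect_eq)
  qed
  show "connected (region_of h)" using convex_region_of[OF assms] convex_connected by blast
next
  fix D :: "('m, 'n) params set"
  assume D: "D \<noteq> {} \<and> region_of h \<subseteq> D \<and> D \<subseteq> - \<Union>arrangement \<and> connected D"
  obtain p where p: "p \<in> region_of h" using region_of_nonempty[OF assms] by blast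
  have "coord q s < coord q t" if q: "q \<in> D" and st: "opp s t" "h s < h t" for q s t
  proof (rule ccontr)
    assume n: "\<not> ?thesis"
    let ?f = "\<lambda>p. coord p s - coord p t"
    have "connected (?f ` D)"
      using D by (intro connected_continuous_image continuous_on_diff continuous_on_coord) auto
    moreover have "?f p \<in> ?f ` D" "?f q \<in> ?f ` D" using p q D by auto
    moreover have "?f p \<le> 0" "0 \<le> ?f q"
      using n p st mem_region_of_iff[OF assms] by (auto simp: less_imp_le)
    ultimately have "0 \<in> ?f ` D" using connectedD_interval by blast
    then obtain r where r: "r \<in> D" "coord r s = coord r t" by auto
    then have "\<exists>i j. x_coord r i = y_coord r j"
      using st by (cases s; cases t) (auto, metis)
    then have "r \<in> \<Union>arrangement" by (auto simp: arrangement_def)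
    then show False using r D by auto
  qed
  then have "D \<subseteq> region_of h" using mem_region_of_iff[OF assms] by auto
  then show "D = region_of h" using D by blast
qed

lemma continuous_on_g: "continuous_on S g"
proof -
  have eq: "g = (\<lambda>p. \<chi> i j. min (fst p $ i + fst (snd (snd p)) $ j) (fst (snd p) $ i + snd (snd (snd p)) $ j))"
    by (auto simp: g_def fun_eq_iff)
  show ?thesis unfolding eq by (intro continuous_intros)
qed

lemma compatible_imp_closure_region:
  assumes "proper h" "compatible h (coord p)"
  shows "p \<in> closure (region_of h)"
proof -
  obtain q where q: "q \<in> region_of h" using region_of_nonempty[OF assms(1)] by blast
  \<comment> \<open>Adding a small positive multiple of a point of the region makes every weak
    inequality at \<open>p\<close> strict.\<close>
  have "1 *\<^sub>R p + inverse (real (Suc n)) *\<^sub>R q \<in> region_of h" for n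
    unfolding mem_region_of_iff[OF assms(1)] coord_lin
  proof (intro allI impI)
    fix s t assume "opp s t \<and> h s < h t"
    then have "coord p s \<le> coord p t" "coord q s < coord q t"
      using assms(2) q mem_region_of_iff[OF assms(1)] by (auto simp: compatible_def)
    then show "1 * coord p s + inverse (real (Suc n)) * coord q s
        < 1 * coord p t + inverse (real (Suc n)) * coord q t"
      by (intro add_le_less_mono mult_strict_left_mono) auto
  qed
  moreover have "(\<lambda>n. 1 *\<^sub>R p + inverse (real (Suc n)) *\<^sub>R q) \<longlonglongrightarrow> 1 *\<^sub>R p + 0 *\<^sub>R q"
    by (intro tendsto_intros LIMSEQ_inverse_real_of_nat)
  ultimately show ?thesis unfolding closure_sequential by (auto intro!: exI)
qed

lemma cell_region_of:
  assumes "proper h"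
  shows "cell (region_of h) = cone_at h"
proof
  have "g p \<in> cone_at h" if "p \<in> region_of h" for p
  proof -
    have "compatible h (coord p)"
      using that mem_region_of_iff[OF assms, of p] by (simp add: compatible_def less_imp_le)
    then show ?thesis using represents_g[of p] mem_cone_at_iff[OF assms] by blast
  qed
  moreover have "closed (cone_at h)" by (intro polyhedron_imp_closed polyhedron_cone_of)
  ultimately show "cell (region_of h) \<subseteq> cone_at h"
    unfolding cell_def by (intro closure_minimal) auto
next
  show "cone_at h \<subseteq> cell (region_of h)"
  proof
    fix M assume "M \<in> cone_at h"
    then obtain p where p: "g p = M" "compatible h (coord p)"
      using mem_cone_at_iff[OF assms] represents_imp_ex_g by metis
    have "g ` closure (region_of h) \<subseteq> closure (g ` region_of h)"
      by (intro image_closure_subset continuous_on_g closure_subset) auto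
    then show "M \<in> cell (region_of h)"
      using compatible_imp_closure_region[OF assms p(2)] p(1) by (auto simp: cell_def)
  qed
qed

section \<open>Dimension of cells\<close>

text \<open>On the orthogonal complement of its kernel \<open>f\<close> is injective and already
  attains its whole range.\<close>

lemma dim_range_plus_dim_kernel:
  fixes f :: "'a::euclidean_space \<Rightarrow> 'b::euclidean_space"
  assumes "linear f"
  shows "dim (range f) + dim {x. f x = 0} = DIM('a)"
proof -
  define K where "K = {x. f x = 0}"
  define C where "C = {y \<in> UNIV. \<forall>x\<in>K. orthogonal x y}"
  have K: "subspace K" unfolding K_def by (rule linear_subspace_kernel[OF assms])
  have C: "subspace C" unfolding C_def using subspace_orthogonal_to_vectors by auto
  have "dim C + dim K = dim (UNIV :: 'a set)"
    unfolding C_def by (rule dim_subspace_orthogonal_to_vectors[OF K subspace_UNIV]) auto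
  moreover have "dim (f ` C) = dim C"
  proof (rule dim_image_eq[OF assms])
    show "inj_on f (span C)"
    proof (rule inj_onI)
      fix x y assume xy: "x \<in> span C" "y \<in> span C" "f x = f y"
      then have "x - y \<in> C" using C by (metis span_eq_iff subspace_diff)
      moreover have "x - y \<in> K" using xy(3) assms by (simp add: K_def linear_diff)
      ultimately show "x = y" by (auto simp: C_def orthogonal_self)
    qed
  qed
  moreover have "range f = f ` C"
  proof -
    have "f x \<in> f ` C" for x
    proof -
      obtain y z where yz: "y \<in> span K" "\<And>w. w \<in> span K \<Longrightarrow> orthogonal z w" "x = y + z"
        using orthogonal_subspace_decomp_exists[of K x] by metis
      have "y \<in> K" using yz(1) K by (metis span_eq_iff)
      then have "f x = f z" using yz(3) assms by (simp add: linear_add K_def)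
      moreover have "z \<in> C" using yz(2) by (auto simp: C_def orthogonal_commute span_base)
      ultimately show ?thesis by blast
    qed
    then show ?thesis by auto
  qed
  ultimately show ?thesis by (simp add: K_def)
qed

definition linear_piece :: "('m::finite \<Rightarrow> 'n::finite \<Rightarrow> bool) \<Rightarrow> ('m, 'n) params \<Rightarrow> real^'n^'m" where
  "linear_piece P = (\<lambda>(a, A, b, B). \<chi> i j. if P i j then a $ i + b $ j else A $ i + B $ j)"

lemma linear_linear_piece: "linear (linear_piece P)"
  by (rule linearI) (auto simp: linear_piece_def vec_eq_iff algebra_simps)

lemma linear_piece_eq_g: "p \<in> region_of h \<Longrightarrow> linear_piece (below h) p = g p"
proof -
  assume p: "p \<in> region_of h"
  obtain a A b B where q: "p = (a, A, b, B)" by (cases p)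
  have "if below h i j then a $ i - A $ i < B $ j - b $ j else a $ i - A $ i > B $ j - b $ j" for i j
  proof -
    have "if below h i j then x_coord p i < y_coord p j else x_coord p i > y_coord p j"
      using p unfolding region_of_def by blast
    then show ?thesis by (simp add: q x_coord_def y_coord_def split: if_splits)
  qed
  then have "(if below h i j then a $ i + b $ j else A $ i + B $ j) = min (a $ i + b $ j) (A $ i + B $ j)" for i j
    by (smt (verit, best))
  then show ?thesis unfolding q linear_piece_def g_def by simp
qed

text \<open>The region is open and nonempty, so its affine hull is the full parameter space, and
  that of the cell is the range of the linear map agreeing with \<open>g\<close> there.\<close>

lemma aff_dim_cell:
  fixes h :: "'m::finite + 'n::finite \<Rightarrow> real"
  assumes "proper h"
  shows "aff_dim (cell (region_of h)) = dim (range (linear_piece (below h)))"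
proof -
  have "affine hull (g ` region_of h) = affine hull (linear_piece (below h) ` region_of h)"
    by (metis (no_types, lifting) image_cong linear_piece_eq_g)
  also have "\<dots> = linear_piece (below h) ` (affine hull (region_of h))"
    by (intro affine_hull_linear_image[symmetric] linear_conv_bounded_linear[THEN iffD1] linear_linear_piece)
  also have "affine hull (region_of h) = UNIV"
    by (rule affine_hull_open[OF open_region_of region_of_nonempty]) (fact assms)+
  finally have "affine hull (cell (region_of h)) = range (linear_piece (below h))"
    by (simp add: cell_def)
  then have "aff_dim (cell (region_of h)) = aff_dim (range (linear_piece (below h)))"
    by (metis aff_dim_affine_hull)
  also have "\<dots> = dim (range (linear_piece (below h)))"
    by (intro aff_dim_subspace linear_subspace_image linear_linear_piece subspace_UNIV)
  finally show ?thesis .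
qed

lemma linear_piece_eq_0_iff:
  "linear_piece P (a, A, b, B) = 0 \<longleftrightarrow>
    (\<forall>i j. (P i j \<longrightarrow> a $ i + b $ j = 0) \<and> (\<not> P i j \<longrightarrow> A $ i + B $ j = 0))"
  by (auto simp: linear_piece_def vec_eq_iff)

text \<open>Every edge of the bipartite graph \<open>below h\<close> is joined to the edge
  \<open>(i0, j0)\<close> of extreme letters, so the graph is connected apart from isolated
  letters.\<close>

lemma below_sum_zero_const:
  fixes h :: "'m::finite + 'n::finite \<Rightarrow> real" and a :: "'m \<Rightarrow> real" and b :: "'n \<Rightarrow> real"
  assumes "\<And>i j. below h i j \<Longrightarrow> a i + b j = 0"
  shows "\<exists>c. \<forall>i j. below h i j \<longrightarrow> a i = c \<and> b j = - c"
proof -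
  obtain i0 where i0: "\<And>i. h (Inl i0) \<le> h (Inl i)"
    using ex_min_if_finite[of "range (h \<circ> Inl)"] by (auto simp: not_less)
  obtain j0 where j0: "\<And>j. h (Inr j) \<le> h (Inr j0)"
    using ex_min_if_finite[of "range (\<lambda>j. - h (Inr j))"] by (auto simp: not_less)
  have "a i = a i0 \<and> b j = - a i0" if "below h i j" for i j
  proof -
    have "below h i0 j" "below h i j0" "below h i0 j0"
      using that i0[of i] j0[of j] by (auto simp: below_def)
    then show ?thesis using assms that by (metis add.commute add.inverse_unique minus_unique)
  qed
  then show ?thesis by blast
qed

text \<open>Each bottom or top letter has one parameter that no entry reads, and each of the graphs
  \<open>below h\<close> and its complement adds one translation. If both graphs have edges, the
  dimension is the number of letters in the two extreme blocks plus 2; otherwise it is at least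
  5.\<close>

lemma dim_kernel_linear_piece:
  fixes h :: "'m::finite + 'n::finite \<Rightarrow> real"
  assumes ph: "proper h" and card: "CARD('m) \<ge> 2" "CARD('n) \<ge> 2"
  shows "dim {p. linear_piece (below h) p = 0} = 4 \<longleftrightarrow> ends h"
proof -
  define K where "K = {p. linear_piece (below h) p = 0}"
  \<comment> \<open>The unread parameter of an extreme letter: a positive letter below all negative
    ones never uses its \<open>A\<close>, a negative one below all positive ones never uses its
    \<open>b\<close>, and top letters never use \<open>a\<close> or \<open>B\<close>.\<close>
  define e :: "'m + 'n \<Rightarrow> ('m, 'n) params" where
    "e s = (if s \<in> bottom h
       then (case s of Inl i \<Rightarrow> (0, axis i 1, 0, 0) | Inr j \<Rightarrow> (0, 0, axis j 1, 0))
       else (case s of Inl i \<Rightarrow> (axis i 1, 0, 0, 0) | Inr j \<Rightarrow> (0, 0, 0, axis j 1)))" for s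
  \<comment> \<open>The translations \<open>(a + c, b - c)\<close> and
    \<open>(A + c, B - c)\<close>, restricted to letters with an edge so that they are orthogonal to
    the unread parameters.\<close>
  define v :: "('m, 'n) params" where
    "v = (\<chi> i. if \<exists>j. below h i j then 1 else 0, 0, \<chi> j. if \<exists>i. below h i j then - 1 else 0, 0)"
  define w :: "('m, 'n) params" where
    "w = (0, \<chi> i. if \<exists>j. \<not> below h i j then 1 else 0, 0, \<chi> j. if \<exists>i. \<not> below h i j then - 1 else 0)"
  have not_below: "\<not> below h i j \<longleftrightarrow> h (Inr j) < h (Inl i)" for i j
    using ph unfolding below_def proper_def by (metis linorder_neq_iff order_less_asym opp_simps(1))
  have botl: "Inl i \<in> bottom h \<longleftrightarrow> (\<forall>j. below h i j)" for i
    by (auto simp: bottom_def below_def opp_def) (metis obj_sumE sum.disc(1) isl_def)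
  have botr: "Inr j \<in> bottom h \<longleftrightarrow> (\<forall>i. \<not> below h i j)" for j
    unfolding not_below by (auto simp: bottom_def opp_def) (metis obj_sumE sum.disc(2))
  have topl: "Inl i \<in> bottom (- h) \<longleftrightarrow> (\<forall>j. \<not> below h i j)" for i
    unfolding not_below by (auto simp: bottom_def opp_def) (metis obj_sumE sum.disc(1) isl_def)
  have topr: "Inr j \<in> bottom (- h) \<longleftrightarrow> (\<forall>i. below h i j)" for j
    by (auto simp: bottom_def below_def opp_def) (metis obj_sumE sum.disc(2))
  define F where "F = bottom h \<union> bottom (- h)"
  have disj: "bottom h \<inter> bottom (- h) = {}"
  proof -
    have "s \<notin> bottom h \<or> s \<notin> bottom (- h)" for s
      by (cases s) (auto simp: botl botr topl topr)
    then show ?thesis by blast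
  qed
  have K: "subspace K" unfolding K_def by (rule linear_subspace_kernel[OF linear_linear_piece])
  have Fe: "e s \<in> K" if "s \<in> F" for s
    using that disj by (cases s)
      (auto simp: F_def K_def e_def linear_piece_eq_0_iff botl botr topl topr axis_def)
  have vw: "v \<in> K" "w \<in> K"
    by (auto simp: K_def v_def w_def linear_piece_eq_0_iff)
  have orth_e: "orthogonal (e s) (e t)" if "s \<noteq> t" for s t
    using that by (cases s; cases t) (auto simp: e_def orthogonal_def inner_axis_axis)
  have orth_v: "orthogonal (e s) v" "orthogonal (e s) w" if "s \<in> F" for s
    using that by (cases s; force simp: F_def e_def v_def w_def orthogonal_def inner_axis' botl botr topl topr)+
  have orth_vw: "orthogonal v w" by (simp add: v_def w_def orthogonal_def)
  have e0: "e s \<noteq> 0" for s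
    by (cases s) (auto simp: e_def axis_eq_0_iff zero_prod_def)
  have inj_e: "inj_on e F"
    using orth_e e0 by (metis inj_onI orthogonal_self)
  have card_F: "card (e ` F) = card (bottom h) + card (bottom (- h))"
    using card_image[OF inj_e] disj by (simp add: F_def card_Un_disjoint)
  define S where "S = e ` F \<union> ({v, w} - {0})"
  have "orthogonal x y" if "x \<in> S" "y \<in> S" "x \<noteq> y" for x y
  proof -
    have "orthogonal (e s) (e t)" if "e s \<noteq> e t" for s t
      using that orth_e by metis
    then show ?thesis
      using that orth_v orth_vw unfolding S_def by (auto simp: orthogonal_commute)
  qed
  then have pw: "pairwise orthogonal S" by (auto simp: pairwise_def)
  have S0: "0 \<notin> S" using e0 by (auto simp: S_def)
  have ind: "independent S" using pairwise_orthogonal_independent[OF pw S0] .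
  have SK: "S \<subseteq> K" using Fe vw by (auto simp: S_def)
  have ev: "v \<noteq> 0 \<Longrightarrow> v \<notin> e ` F" "w \<noteq> 0 \<Longrightarrow> w \<notin> e ` F"
    using orth_v by (metis imageE orthogonal_self)+
  have vw_ne: "v \<noteq> w" if "v \<noteq> 0" using that orth_vw by (auto simp: orthogonal_self)
  have v0: "v = 0 \<Longrightarrow> \<not> below h i j" for i j
    by (auto simp: v_def zero_prod_def vec_eq_iff split: if_splits)
  have w0: "w = 0 \<Longrightarrow> below h i j" for i j
    by (auto simp: w_def zero_prod_def vec_eq_iff split: if_splits)
  show ?thesis
  proof (cases "v = 0 \<or> w = 0")
    case True
    \<comment> \<open>One graph is empty, so one sign fills the bottom block and the other the top
      block.\<close>
    then have all: "(\<forall>i j. \<not> below h i j) \<or> (\<forall>i j. below h i j)" using v0 w0 by blast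
    then have "range Inr \<subseteq> bottom h \<and> range Inl \<subseteq> bottom (- h)
      \<or> range Inl \<subseteq> bottom h \<and> range Inr \<subseteq> bottom (- h)"
      by (auto simp: botl botr topl topr)
    then have le: "CARD('m) + CARD('n) \<le> card (bottom h) + card (bottom (- h))" "card (bottom h) \<ge> 2"
      using card_mono[of "bottom h" "range Inr"] card_mono[of "bottom h" "range Inl"]
        card_mono[of "bottom (- h)" "range Inr"] card_mono[of "bottom (- h)" "range Inl"] card
      by (auto simp: card_image)
    have "\<not> (v = 0 \<and> w = 0)" using v0 w0 by blast
    then have "card (insert (if v = 0 then w else v) (e ` F)) = Suc (card (e ` F))"
      using ev by (subst card_insert_disjoint) auto
    moreover have "card (insert (if v = 0 then w else v) (e ` F)) \<le> card S"
      using \<open>\<not> (v = 0 \<and> w = 0)\<close> by (intro card_mono) (auto simp: S_def)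
    moreover have "4 \<le> card (e ` F)" using le(1) card card_F by linarith
    ultimately have "5 \<le> card S" by linarith
    then have "dim K \<noteq> 4" using independent_card_le_dim[OF SK ind] by simp
    moreover have "\<not> ends h" using le(2) by (auto simp: ends_def is_singleton_altdef)
    ultimately show ?thesis by (simp add: K_def)
  next
    case False
    have "S = insert v (insert w (e ` F))" using False by (auto simp: S_def)
    then have cardS: "card S = card (bottom h) + card (bottom (- h)) + 2"
      using ev vw_ne False card_F by simp
    have "K \<subseteq> span S"
    proof (rule ccontr)
      assume "\<not> K \<subseteq> span S"
      then have "span S \<subset> span K"
        using SK K span_mono[OF SK] by (metis psubsetI span_eq_iff)
      then obtain x where x: "x \<noteq> 0" "x \<in> span K" "\<And>y. y \<in> span S \<Longrightarrow> orthogonal x y"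
        using orthogonal_to_subspace_exists_gen by metis
      obtain a A b B where xe: "x = (a, A, b, B)" by (cases x)
      have xK: "x \<in> K" using x(2) K by (metis span_eq_iff)
      obtain c where c: "\<And>i j. below h i j \<Longrightarrow> a $ i = c \<and> b $ j = - c"
        using below_sum_zero_const[of h "($) a" "($) b"] xK by (auto simp: K_def xe linear_piece_eq_0_iff)
      obtain d where d: "\<And>i j. \<not> below h i j \<Longrightarrow> A $ i = d \<and> B $ j = - d"
        using below_sum_zero_const[of "- h" "($) A" "($) B"] xK
        by (auto simp: K_def xe linear_piece_eq_0_iff below_uminus[OF ph])
      have xv: "x \<bullet> v = 0" "x \<bullet> w = 0" "\<And>s. s \<in> F \<Longrightarrow> x \<bullet> e s = 0"
        using x(3) False by (auto simp: S_def orthogonal_def span_base)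
      have "x \<bullet> v = c * (v \<bullet> v)"
        unfolding xe v_def using c
        by (auto simp: inner_vec_def distrib_left sum_distrib_left intro!: arg_cong2[where f = "(+)"] sum.cong)
      then have c0: "c = 0" using xv(1) False by simp
      have "x \<bullet> w = d * (w \<bullet> w)"
        unfolding xe w_def using d
        by (auto simp: inner_vec_def distrib_left sum_distrib_left intro!: arg_cong2[where f = "(+)"] sum.cong)
      then have d0: "d = 0" using xv(2) False by simp
      have "a $ i = 0" for i
        using c[of i] c0 xv(3)[of "Inl i"] disj
        by (cases "\<exists>j. below h i j") (auto simp: F_def topl botl e_def xe inner_axis)
      moreover have "A $ i = 0" for i
        using d[of i] d0 xv(3)[of "Inl i"]
        by (cases "\<exists>j. \<not> below h i j") (auto simp: F_def topl botl e_def xe inner_axis)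
      moreover have "b $ j = 0" for j
        using c[of _ j] c0 xv(3)[of "Inr j"]
        by (cases "\<exists>i. below h i j") (auto simp: F_def topr botr e_def xe inner_axis)
      moreover have "B $ j = 0" for j
        using d[of _ j] d0 xv(3)[of "Inr j"]
        by (cases "\<exists>i. \<not> below h i j") (auto simp: F_def topr botr e_def xe inner_axis)
      ultimately have "x = 0" by (simp add: xe zero_prod_def vec_eq_iff)
      then show False using x(1) by simp
    qed
    then have dimK: "dim K = card (bottom h) + card (bottom (- h)) + 2"
      using dim_unique[OF SK _ ind] cardS by simp
    have ne: "bottom h \<noteq> {}" if "proper h" for h :: "'m + 'n \<Rightarrow> real"
    proof -
      obtain s where s: "\<And>t. h s \<le> h t"
        using ex_min_if_finite[of "range h"] by (auto simp: not_less)
      have "s \<in> bottom h" using s that by (auto simp: bottom_def proper_def less_le)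
      then show ?thesis by blast
    qed
    have "card (bottom h) > 0" "card (bottom (- h)) > 0"
      using ne[of h] ne[of "- h"] ph by (auto simp: card_gt_0_iff)
    then show ?thesis using dimK unfolding ends_def is_singleton_altdef K_def by arith
  qed
qed

lemma max_dimensional_cell_iff:
  fixes h :: "'m::finite + 'n::finite \<Rightarrow> real"
  assumes "proper h" "CARD('m) \<ge> 2" "CARD('n) \<ge> 2"
  shows "max_dimensional (cell (region_of h)) \<longleftrightarrow> ends h"
  using dim_range_plus_dim_kernel[OF linear_linear_piece[of "below h"]] dim_kernel_linear_piece[OF assms]
  by (auto simp: max_dimensional_def aff_dim_cell[OF assms(1)])

section \<open>Labels and height functions\<close>

lemma order_cong:
  assumes "\<And>s t. opp s t \<Longrightarrow> h s < h t \<longleftrightarrow> h' s < h' t"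
  shows "bottom h = bottom h'" "second h = second h'" "bottom (- h) = bottom (- h')" "second (- h) = second (- h')"
proof -
  have b: "bottom k = bottom k' \<and> second k = second k'" if "\<And>s t. opp s t \<Longrightarrow> k s < k t \<longleftrightarrow> k' s < k' t"
    for k k' :: "'a + 'b \<Rightarrow> real"
  proof -
    have "bottom k = bottom k'" using that by (auto simp: bottom_def)
    then show ?thesis using that by (auto simp: second_def)
  qed
  show "bottom h = bottom h'" "second h = second h'" using b[of h h'] assms by auto
  have "(- h) s < (- h) t \<longleftrightarrow> (- h') s < (- h') t" if "opp s t" for s t
    using assms[OF opp_sym[OF that]] by simp
  then show "bottom (- h) = bottom (- h')" "second (- h) = second (- h')" using b[of "- h" "- h'"] by auto
qed

text \<open>\<open>pos s\<close> is the index of the block containing \<open>s\<close>, and \<open>N\<close> is the number of blocks.\<close>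

definition levels :: "('a + 'b) set \<Rightarrow> ('a + 'b \<Rightarrow> nat) \<Rightarrow> nat \<Rightarrow> bool" where
  "levels U pos N \<longleftrightarrow> pos ` U = {..<N} \<and> (\<forall>s\<in>U. \<forall>t\<in>U. opp s t \<longrightarrow> pos s \<noteq> pos t) \<and>
     (\<forall>s\<in>U. \<forall>t\<in>U. pos t = Suc (pos s) \<longrightarrow> opp s t)"

text \<open>Letters are added by increasing height: a new letter joins the last block if the signs
  agree and opens a new block otherwise.\<close>

lemma ex_levels:
  assumes "finite U" "\<And>s t. s \<in> U \<Longrightarrow> t \<in> U \<Longrightarrow> opp s t \<Longrightarrow> (h s :: real) \<noteq> h t"
  shows "\<exists>pos N. levels U pos N \<and> (\<forall>s\<in>U. \<forall>t\<in>U. opp s t \<and> h s < h t \<longrightarrow> pos s < pos t)"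
  using assms
proof (induction U rule: finite_ranking_induct[where f = h])
  case empty
  show ?case by (intro exI[of _ "\<lambda>_. 0"] exI[of _ 0]) (simp add: levels_def)
next
  case (insert x S)
  obtain pos N where IH: "levels S pos N" "\<And>s t. s \<in> S \<Longrightarrow> t \<in> S \<Longrightarrow> opp s t \<Longrightarrow> h s < h t \<Longrightarrow> pos s < pos t"
    using insert.IH insert.prems by blast
  show ?case
  proof (cases "x \<in> S")
    case True
    then show ?thesis using IH by (auto simp: insert_absorb)
  next
    case xS: False
    have im: "pos ` S = {..<N}"
      and ne: "\<And>s t. s \<in> S \<Longrightarrow> t \<in> S \<Longrightarrow> opp s t \<Longrightarrow> pos s \<noteq> pos t"
      and su: "\<And>s t. s \<in> S \<Longrightarrow> t \<in> S \<Longrightarrow> pos t = Suc (pos s) \<Longrightarrow> opp s t"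
      using IH(1) by (auto simp: levels_def)
    have lt: "pos s < N" if "s \<in> S" for s using im that by blast
    have irr: "\<not> opp x x" by (simp add: opp_def)
    have hx: "\<not> h x < h s" if "s \<in> S" for s using insert.hyps(2)[OF that] by simp
    show ?thesis
    proof (cases N)
      case 0
      then have "S = {}" using im by auto
      then show ?thesis
        by (intro exI[of _ "\<lambda>_. 0"] exI[of _ 1]) (auto simp: levels_def opp_def)
    next
      case (Suc M)
      then obtain y where y: "y \<in> S" "pos y = M" using im by (metis imageE lessI lessThan_iff)
      show ?thesis
      proof (cases "opp x y")
        case True
        let ?p = "pos(x := N)"
        have same: "?p s = pos s" if "s \<in> S" for s using that xS by auto
        have top: "opp s x" if "s \<in> S" "N = Suc (pos s)" for s
          using ne[OF that(1) y(1)] that(2) Suc y(2) True by (auto simp: opp_def)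
        have "?p ` S = pos ` S" using same by (intro image_cong) auto
        then have "?p ` insert x S = insert N (pos ` S)" unfolding image_insert by simp
        then have "?p ` insert x S = {..<Suc N}" using im by auto
        moreover have "?p s \<noteq> ?p t" if "s \<in> insert x S" "t \<in> insert x S" "opp s t" for s t
          using that ne[of s t] lt[of s] lt[of t] irr by auto
        moreover have "opp s t" if "s \<in> insert x S" "t \<in> insert x S" "?p t = Suc (?p s)" for s t
          using that su[of s t] lt[of t] top[of s] by (auto split: if_splits)
        moreover have "?p s < ?p t" if "s \<in> insert x S" "t \<in> insert x S" "opp s t" "h s < h t" for s t
          using that IH(2)[of s t] lt[of s] hx[of t] by auto
        ultimately show ?thesis by (intro exI[of _ ?p] exI[of _ "Suc N"]) (simp add: levels_def del: fun_upd_apply)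
      next
        case False
        let ?p = "pos(x := M)"
        have same: "?p s = pos s" if "s \<in> S" for s using that xS by auto
        have yx: "opp s x \<longleftrightarrow> opp s y" "opp x s \<longleftrightarrow> opp y s" for s using False by (auto simp: opp_def)
        have "?p ` S = pos ` S" using same by (intro image_cong) auto
        then have "?p ` insert x S = insert M (pos ` S)" unfolding image_insert by simp
        then have "?p ` insert x S = {..<N}" using im Suc by auto
        moreover have "?p s \<noteq> ?p t" if "s \<in> insert x S" "t \<in> insert x S" "opp s t" for s t
          using that ne[of s t] ne[of s y] ne[of y t] y yx irr by auto
        moreover have "opp s t" if "s \<in> insert x S" "t \<in> insert x S" "?p t = Suc (?p s)" for s t
          using that su[of s t] su[of s y] lt[of t] y yx Suc by (auto split: if_splits)
        moreover have "?p s < ?p t" if "s \<in> insert x S" "t \<in> insert x S" "opp s t" "h s < h t" for s t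
        proof (cases "t = x")
          case True
          then have s: "s \<in> S" "opp s y" using that irr yx by auto
          then have "pos s \<noteq> M" "pos s < N" using ne[of s y] y lt by auto
          then show ?thesis using True s(1) xS Suc by auto
        next
          case False
          then show ?thesis using that IH(2)[of s t] hx[of t] by auto
        qed
        ultimately show ?thesis by (intro exI[of _ ?p] exI[of _ N]) (simp add: levels_def del: fun_upd_apply)
      qed
    qed
  qed
qed

text \<open>Consecutive blocks have opposite signs, so the sign of a letter is the parity of its
  block index up to a global choice.\<close>

lemma levels_opp_iff:
  assumes "levels UNIV pos N"
  shows "opp s t \<longleftrightarrow> even (pos s) \<noteq> even (pos t)"
proof -
  have im: "range pos = {..<N}" and ne: "\<And>s t. opp s t \<Longrightarrow> pos s \<noteq> pos t"
    and su: "\<And>s t. pos t = Suc (pos s) \<Longrightarrow> opp s t"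
    using assms by (auto simp: levels_def)
  have "0 < N" using im by (metis gr0I lessThan_0 UNIV_not_empty image_is_empty)
  then obtain z where z: "pos z = 0" using im by (metis imageE lessThan_iff)
  have "opp z s \<longleftrightarrow> odd (pos s)" for s
  proof (induction "pos s" arbitrary: s)
    case 0
    then show ?case using ne[of z s] z by auto
  next
    case (Suc n)
    have "Suc n < N" using im Suc(2) by (metis lessThan_iff rangeI)
    then obtain t where t: "pos t = n" using im by (metis Suc_lessD imageE lessThan_iff)
    then have "opp t s" using su Suc(2) by simp
    then have "opp z s \<longleftrightarrow> \<not> opp z t" by (auto simp: opp_def)
    then show ?case using Suc(1)[of t] t Suc(2)[symmetric] by simp
  qed
  then show ?thesis by (auto simp: opp_def)
qed

lemma levels_proper: "levels UNIV pos N \<Longrightarrow> proper (\<lambda>s. real (pos s))"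
  by (auto simp: levels_def proper_def)

lemma levels_ge_2:
  assumes "levels (UNIV :: ('a + 'b) set) pos N"
  shows "2 \<le> N"
proof -
  have "pos (Inl (undefined :: 'a)) \<noteq> pos (Inr (undefined :: 'b))" "\<And>s. pos s < N"
    using assms by (auto simp: levels_def)
  then show ?thesis by (metis Suc_1 Suc_leI less_2_cases_iff linorder_not_less less_trans_Suc nat_neq_iff not_less_zero zero_less_iff_neq_zero)
qed

lemma bottom_levels:
  assumes "levels UNIV pos N"
  shows "bottom (\<lambda>s. real (pos s)) = {s. pos s = 0}" "second (\<lambda>s. real (pos s)) = {s. pos s = 1}"
proof -
  note opp = levels_opp_iff[OF assms]
  have ex: "\<exists>s. pos s = k" if "k < N" for k
    using assms that unfolding levels_def by (metis imageE lessThan_iff)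
  have lt: "pos s < N" for s using assms by (auto simp: levels_def)
  have ge: "pos s < pos t" if "pos s = 0" "opp s t" for s t using that opp by (cases "pos t") auto
  show b: "bottom (\<lambda>s. real (pos s)) = {s. pos s = 0}"
  proof (intro set_eqI iffI)
    fix s assume s: "s \<in> bottom (\<lambda>s. real (pos s))"
    show "s \<in> {s. pos s = 0}"
    proof (rule ccontr)
      assume "\<not> ?thesis"
      then obtain n where n: "pos s = Suc n" by (auto simp: gr0_conv_Suc)
      then obtain t where "pos t = n" using ex[of n] lt[of s] by auto
      then show False using s n opp[of s t] by (auto simp: bottom_def)
    qed
  qed (use ge in \<open>auto simp: bottom_def\<close>)
  show "second (\<lambda>s. real (pos s)) = {s. pos s = 1}"
  proof (intro set_eqI iffI)
    fix s assume s: "s \<in> second (\<lambda>s. real (pos s))"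
    show "s \<in> {s. pos s = 1}"
    proof (rule ccontr)
      assume n: "\<not> ?thesis"
      have "pos s \<noteq> 0" using s b by (auto simp: second_def)
      then have "pos s \<ge> 2" using n by simp
      then obtain n where n: "pos s = Suc (Suc n)" by (metis add_2_eq_Suc le_Suc_ex)
      then obtain t where "pos t = Suc n" using ex[of "Suc n"] lt[of s] by auto
      then show False using s n opp[of s t] b by (auto simp: second_def)
    qed
  next
    fix s assume s: "s \<in> {s. pos s = 1}"
    have "pos s < pos t" if "opp s t" "pos t \<noteq> 0" for t
      using that s opp[of s t] by (cases "pos t = 1") auto
    then show "s \<in> second (\<lambda>s. real (pos s))" using s b by (auto simp: second_def)
  qed
qed

lemma levels_reverse:
  assumes "levels UNIV pos N"
  shows "levels UNIV (\<lambda>s. N - 1 - pos s) N"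
proof -
  have lt: "pos s < N" for s using assms by (auto simp: levels_def)
  have ex: "\<exists>s. pos s = k" if "k < N" for k
    using assms that unfolding levels_def by (metis imageE lessThan_iff)
  have "k \<in> range (\<lambda>s. N - 1 - pos s)" if k: "k < N" for k
  proof -
    obtain s where "pos s = N - 1 - k" using ex[of "N - 1 - k"] k by auto
    then have "k = N - 1 - pos s" using k by simp
    then show ?thesis by blast
  qed
  moreover have "N - 1 - pos s < N" for s using lt[of s] by simp
  ultimately have "range (\<lambda>s. N - 1 - pos s) = {..<N}" by auto
  moreover have "opp s t \<Longrightarrow> pos s \<noteq> pos t" for s t using assms by (auto simp: levels_def)
  then have "opp s t \<Longrightarrow> N - 1 - pos s \<noteq> N - 1 - pos t" for s t
    using lt[of s] lt[of t] by (metis (no_types) Suc_pred' diff_diff_cancel less_Suc_eq_le not_less_zero zero_less_iff_neq_zero)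
  moreover have "opp s t" if "N - 1 - pos t = Suc (N - 1 - pos s)" for s t
  proof -
    have "pos s = Suc (pos t)" using that lt[of s] lt[of t] by linarith
    then have "opp t s" using assms by (simp add: levels_def)
    then show ?thesis by (rule opp_sym)
  qed
  ultimately show ?thesis by (auto simp: levels_def)
qed

lemma top_levels:
  assumes "levels UNIV pos N"
  shows "bottom (- (\<lambda>s. real (pos s))) = {s. pos s = N - 1}"
    "second (- (\<lambda>s. real (pos s))) = {s. pos s = N - 2}"
proof -
  have lt: "pos s < N" for s using assms by (auto simp: levels_def)
  have "(- (\<lambda>s. real (pos s))) s < (- (\<lambda>s. real (pos s))) t \<longleftrightarrow> real (N - 1 - pos s) < real (N - 1 - pos t)" for s t
    using lt[of s] lt[of t] by auto
  note c = order_cong(1,2)[of "- (\<lambda>s. real (pos s))" "\<lambda>s. real (N - 1 - pos s)", OF this]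
  have "N - 1 - pos s = 0 \<longleftrightarrow> pos s = N - 1" "N - 1 - pos s = 1 \<longleftrightarrow> pos s = N - 2" for s
    using lt[of s] levels_ge_2[OF assms] by auto
  then show "bottom (- (\<lambda>s. real (pos s))) = {s. pos s = N - 1}"
    "second (- (\<lambda>s. real (pos s))) = {s. pos s = N - 2}"
    unfolding c bottom_levels[OF levels_reverse[OF assms]] by auto
qed

lemma levels_imp_label:
  assumes L: "levels UNIV pos N" and w: "w = map (\<lambda>k. {s. pos s = k}) [0..<N]"
  shows "alternating_partition w" "precedes w s t \<longleftrightarrow> pos s < pos t"
proof -
  have lt: "pos s < N" for s using L by (auto simp: levels_def)
  have ex: "\<exists>s. pos s = k" if "k < N" for k
    using L that unfolding levels_def by (metis imageE lessThan_iff)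
  have len: "length w = N" and nth: "\<And>k. k < N \<Longrightarrow> w ! k = {s. pos s = k}" by (auto simp: w)
  have "distinct w"
    unfolding w distinct_map
    by (auto intro!: inj_onI) (metis (mono_tags) ex mem_Collect_eq)
  moreover have "partition_on UNIV (set w)"
    using lt ex by (auto simp: w partition_on_def disjoint_def) blast
  moreover have "S \<subseteq> range Inl \<or> S \<subseteq> range Inr" if Sw: "S \<in> set w" for S
  proof -
    obtain k where S: "S = {s. pos s = k}" using Sw by (auto simp: w)
    have "\<not> opp s t" if "s \<in> S" "t \<in> S" for s t
    proof -
      have "pos s = pos t" using that S by simp
      then show ?thesis using L by (auto simp: levels_def)
    qed
    then show ?thesis
      by (metis (no_types, lifting) UNIV_I image_eqI obj_sumE opp_simps(1) subsetI)
  qed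
  moreover have "successively (\<lambda>S T. S \<subseteq> range Inl \<longleftrightarrow> T \<subseteq> range Inr) w"
    unfolding successively_conv_nth len
  proof (intro allI impI)
    fix k assume k: "Suc k < N"
    obtain a b where ab: "pos a = k" "pos b = Suc k" using ex k Suc_lessD by metis
    have sub: "{s. pos s = pos r} \<subseteq> range Inl \<longleftrightarrow> isl r" "{s. pos s = pos r} \<subseteq> range Inr \<longleftrightarrow> \<not> isl r" for r
    proof -
      have "pos s = pos r \<Longrightarrow> isl s = isl r" for s
        using L by (auto simp: levels_def opp_def)
      moreover have "isl s \<longleftrightarrow> s \<in> range Inl" "\<not> isl s \<longleftrightarrow> s \<in> range Inr" for s :: "'a + 'b"
        by (cases s; auto)+
      ultimately show "{s. pos s = pos r} \<subseteq> range Inl \<longleftrightarrow> isl r" "{s. pos s = pos r} \<subseteq> range Inr \<longleftrightarrow> \<not> isl r"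
        by blast+
    qed
    have "opp a b" using L ab by (auto simp: levels_def)
    then show "(w ! k \<subseteq> range Inl) = (w ! Suc k \<subseteq> range Inr)"
      using nth[of k] nth[of "Suc k"] k sub[of a] sub[of b] ab by (simp add: opp_def)
  qed
  ultimately show "alternating_partition w" by (auto simp: alternating_partition_def)
  show "precedes w s t \<longleftrightarrow> pos s < pos t"
  proof
    assume "precedes w s t"
    then show "pos s < pos t" by (auto simp: precedes_def len nth)
  next
    assume "pos s < pos t"
    then show "precedes w s t"
      unfolding precedes_def using lt[of s] lt[of t]
      by (intro exI[of _ "pos s"] exI[of _ "pos t"]) (simp add: len nth)
  qed
qed

lemma label_imp_levels:
  fixes w :: "('a + 'b) set list"
  assumes w: "alternating_partition w"
  shows "\<exists>pos. levels UNIV pos (length w) \<and> (\<forall>k<length w. w ! k = {s. pos s = k}) \<and>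
    (\<forall>s t. precedes w s t \<longleftrightarrow> pos s < pos t)"
proof -
  have d: "distinct w" and p: "partition_on UNIV (set w)"
    and mono: "\<And>S. S \<in> set w \<Longrightarrow> S \<subseteq> range Inl \<or> S \<subseteq> range Inr"
    and succ: "\<And>k. Suc k < length w \<Longrightarrow> w ! k \<subseteq> range Inl \<longleftrightarrow> w ! Suc k \<subseteq> range Inr"
    using w by (auto simp: alternating_partition_def successively_conv_nth)
  have "\<exists>k. k < length w \<and> s \<in> w ! k" for s
    using p by (metis UNIV_I UnionE in_set_conv_nth partition_on_def)
  then obtain pos where pos: "\<And>s. pos s < length w" "\<And>s. s \<in> w ! pos s" by metis
  have uniq: "pos s = k" if "s \<in> w ! k" "k < length w" for s k
  proof -
    have "w ! pos s = w ! k"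
      using p pos[of s] that unfolding partition_on_def disjoint_def
      by (metis disjoint_iff nth_mem)
    then show ?thesis using d pos(1)[of s] that(2) nth_eq_iff_index_eq by blast
  qed
  have nth: "w ! k = {s. pos s = k}" if "k < length w" for k
    using uniq that pos(2) by blast
  have ne: "w ! k \<noteq> {}" if "k < length w" for k
    using p that by (metis nth_mem partition_on_def)
  have isl: "isl s \<longleftrightarrow> w ! pos s \<subseteq> range Inl" "\<not> isl s \<longleftrightarrow> w ! pos s \<subseteq> range Inr" for s
    using mono[of "w ! pos s"] pos[of s] by (cases s; auto)+
  have "levels UNIV pos (length w)"
    unfolding levels_def
  proof (intro conjI ballI impI)
    show "range pos = {..<length w}" using pos(1) ne nth by fastforce
  next
    fix s t :: "'a + 'b" assume "opp s t"
    then show "pos s \<noteq> pos t" using isl[of s] isl[of t] by (auto simp: opp_def)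
  next
    fix s t assume "pos t = Suc (pos s)"
    then show "opp s t" using succ[of "pos s"] pos(1)[of t] isl[of s] isl[of t] by (auto simp: opp_def)
  qed
  moreover have "precedes w s t \<longleftrightarrow> pos s < pos t" for s t
    using pos uniq by (auto simp: precedes_def) 
  ultimately show ?thesis using nth by blast
qed

lemma region_label_imp_height:
  fixes R :: "('m::finite, 'n::finite) params set"
  assumes "region_label R w"
  shows "\<exists>h. proper h \<and> R = region_of h \<and> w ! 1 = second h \<and> w ! (length w - 2) = second (- h)"
proof -
  have alt: "alternating_partition w" using assms by (simp add: region_label_def)
  obtain pos where L: "levels UNIV pos (length w)" and nth: "\<And>k. k < length w \<Longrightarrow> w ! k = {s. pos s = k}"
    and prec: "\<And>s t. precedes w s t \<longleftrightarrow> pos s < pos t"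
    using label_imp_levels[OF alt] by blast
  have "R = region_of (\<lambda>s. real (pos s))"
    using assms by (auto simp: region_label_def region_of_def below_def prec)
  then show ?thesis
    using levels_proper[OF L] bottom_levels(2)[OF L] top_levels(2)[OF L] nth[of 1] nth[of "length w - 2"]
      levels_ge_2[OF L] by (intro exI[of _ "\<lambda>s. real (pos s)"]) auto
qed

lemma proper_levels:
  fixes h :: "'a::finite + 'b::finite \<Rightarrow> real"
  assumes "proper h"
  obtains pos :: "'a + 'b \<Rightarrow> nat" and N where "levels UNIV pos N" "\<And>s t. opp s t \<Longrightarrow> h s < h t \<longleftrightarrow> real (pos s) < real (pos t)"
proof -
  obtain pos N where L: "levels UNIV pos N" and lt: "\<And>s t. opp s t \<Longrightarrow> h s < h t \<Longrightarrow> pos s < pos t"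
    using ex_levels[of UNIV h] assms by (auto simp: proper_def)
  have "h s < h t \<longleftrightarrow> pos s < pos t" if "opp s t" for s t
    using lt[OF that] lt[OF opp_sym[OF that]] assms that unfolding proper_def
    by (metis linorder_neq_iff order_less_asym)
  then show ?thesis using that[OF L] by simp
qed

lemma height_imp_region_label:
  fixes h :: "'m::finite + 'n::finite \<Rightarrow> real"
  assumes "proper h"
  shows "\<exists>w. region_label (region_of h) w \<and> w ! 1 = second h \<and> w ! (length w - 2) = second (- h)"
proof -
  obtain pos N where L: "levels UNIV pos N" and eq: "\<And>s t. opp s t \<Longrightarrow> h s < h t \<longleftrightarrow> real (pos s) < real (pos t)"
    using proper_levels[OF assms] by blast
  define w where "w = map (\<lambda>k. {s. pos s = k}) [0..<N]"
  note lab = levels_imp_label[OF L w_def]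
  have "region_label (region_of h) w"
    using lab eq by (auto simp: region_label_def region_of_def below_def)
  moreover have "second h = {s. pos s = 1}" "second (- h) = {s. pos s = N - 2}"
    using order_cong(2,4)[of h "\<lambda>s. real (pos s)", OF eq] bottom_levels(2)[OF L] top_levels(2)[OF L] by auto
  moreover have "w ! 1 = {s. pos s = 1}" "w ! (length w - 2) = {s. pos s = N - 2}"
    using levels_ge_2[OF L] by (auto simp: w_def)
  ultimately show ?thesis by auto
qed

section \<open>Large and small cells in terms of height functions\<close>

lemma large_cells_eq:
  assumes "CARD('m::finite) \<ge> 2" "CARD('n::finite) \<ge> 2"
  shows "(large_cells :: (real^'n^'m) set set) = {cone_at h |h. proper h \<and> large h}" (is "?L = ?R")
proof (intro set_eqI iffI)
  fix C :: "(real^'n^'m) set" assume "C \<in> ?L"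
  then obtain R :: "('m, 'n) params set" and w where R: "C = cell R" "region_label R w" "max_dimensional (cell R)"
    "\<not> is_singleton (w ! 1)" "\<not> is_singleton (w ! (length w - 2))"
    unfolding large_cells_def by blast
  obtain h where h: "proper h" "R = region_of h" "w ! 1 = second h" "w ! (length w - 2) = second (- h)"
    using region_label_imp_height[OF R(2)] by blast
  then have "large h" using R max_dimensional_cell_iff[OF h(1) assms] by (auto simp: large_def)
  then show "C \<in> ?R" using h R(1) cell_region_of by blast
next
  fix C :: "(real^'n^'m) set" assume "C \<in> ?R"
  then obtain h where h: "C = cone_at h" "proper h" "large h" by blast
  obtain w where w: "region_label (region_of h) w" "w ! 1 = second h" "w ! (length w - 2) = second (- h)"
    using height_imp_region_label[OF h(2)] by blast
  have "C = cell (region_of h)" using cell_region_of h by blast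
  moreover have "max_dimensional (cell (region_of h))"
    using h(3) max_dimensional_cell_iff[OF h(2) assms] by (simp add: large_def)
  ultimately show "C \<in> ?L"
    unfolding large_cells_def using h(3) w region_of_mem_regions[OF h(2)]
    by (intro CollectI exI[of _ "region_of h"] exI[of _ w]) (auto simp: large_def)
qed

lemma small_cells_eq:
  assumes "CARD('m::finite) \<ge> 2" "CARD('n::finite) \<ge> 2"
  shows "(small_cells :: (real^'n^'m) set set) = {cone_at h |h. proper h \<and> small h}" (is "?L = ?R")
proof (intro set_eqI iffI)
  fix C :: "(real^'n^'m) set" assume "C \<in> ?L"
  then obtain R :: "('m, 'n) params set" and w where R: "C = cell R" "region_label R w" "max_dimensional (cell R)"
    "is_singleton (w ! 1)" "is_singleton (w ! (length w - 2))"
    unfolding small_cells_def by blast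
  obtain h where h: "proper h" "R = region_of h" "w ! 1 = second h" "w ! (length w - 2) = second (- h)"
    using region_label_imp_height[OF R(2)] by blast
  then have "small h" using R max_dimensional_cell_iff[OF h(1) assms] by (auto simp: small_def)
  then show "C \<in> ?R" using h R(1) cell_region_of by blast
next
  fix C :: "(real^'n^'m) set" assume "C \<in> ?R"
  then obtain h where h: "C = cone_at h" "proper h" "small h" by blast
  obtain w where w: "region_label (region_of h) w" "w ! 1 = second h" "w ! (length w - 2) = second (- h)"
    using height_imp_region_label[OF h(2)] by blast
  have "C = cell (region_of h)" using cell_region_of h by blast
  moreover have "max_dimensional (cell (region_of h))"
    using h(3) max_dimensional_cell_iff[OF h(2) assms] by (simp add: small_def)
  ultimately show "C \<in> ?L"
    unfolding small_cells_def using h(3) w region_of_mem_regions[OF h(2)]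
    by (intro CollectI exI[of _ "region_of h"] exI[of _ w]) (auto simp: small_def)
qed

section \<open>Small cells cover and refine\<close>

text \<open>The letter \<open>u\<close>, lowest among the remaining ones and of the sign of
  \<open>b\<close>, closes the second block right after \<open>b'\<close>.\<close>

lemma bottom_second_pair:
  assumes "opp b b'" "h b < h b'" "\<And>r. r \<noteq> b \<Longrightarrow> r \<noteq> b' \<Longrightarrow> h b' < h r"
    and u: "u \<noteq> b" "u \<noteq> b'" "\<not> opp b u" "\<And>r. r \<noteq> b \<Longrightarrow> r \<noteq> b' \<Longrightarrow> h u \<le> h r"
  shows "bottom h = {b}" "second h = {b'}"
proof -
  have gt: "h b < h r" if "r \<noteq> b" for r using that assms(2) assms(3)[of r] by (cases "r = b'") auto
  have ob: "r \<noteq> b" if "opp b r" for r using that by (auto simp: opp_def)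
  have b: "b \<in> bottom h" using gt ob by (auto simp: bottom_def)
  have "r \<notin> bottom h" if "r \<noteq> b" for r
  proof (cases "opp b r")
    case True
    then show ?thesis using gt[OF that] by (auto simp: bottom_def opp_def)
  next
    case False
    then have "opp r b'" "r \<noteq> b'" using assms(1) by (auto simp: opp_def)
    then show ?thesis using assms(3)[OF that] by (auto simp: bottom_def)
  qed
  then show eq: "bottom h = {b}" using b by blast
  have "b' \<in> second h"
    using assms by (auto simp: second_def eq opp_def)
  moreover have "r \<notin> second h" if "r \<noteq> b'" for r
  proof (cases "opp b r")
    case True
    then have "opp r u" "r \<noteq> b" using u by (auto simp: opp_def)
    then show ?thesis using u(4)[of r] u(1) that by (auto simp: second_def eq)
  next
    case False
    show ?thesis
    proof (cases "r = b")
      case True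
      then show ?thesis by (simp add: second_def eq)
    next
      case ne: False
      have "opp r b'" "b' \<noteq> b" using assms(1) False by (auto simp: opp_def)
      then show ?thesis using assms(3)[OF ne that] by (auto simp: second_def eq)
    qed
  qed
  ultimately show "second h = {b'}" by blast
qed

lemma bottom_second_large:
  assumes "\<And>r. r \<noteq> b \<Longrightarrow> h b < h r" "opp b c" "opp b d" "c \<noteq> d"
    and "\<And>r. r \<noteq> b \<Longrightarrow> \<not> opp b r \<Longrightarrow> h c < h r \<and> h d < h r"
  shows "bottom h = {b}" "\<not> is_singleton (second h)"
proof -
  have ob: "r \<noteq> b" if "opp b r" for r using that by (auto simp: opp_def)
  have b: "b \<in> bottom h" using assms(1) ob by (auto simp: bottom_def)
  have "r \<notin> bottom h" if "r \<noteq> b" for r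
  proof (cases "opp b r")
    case True
    then show ?thesis using assms(1)[OF that] by (auto simp: bottom_def opp_def)
  next
    case False
    then have "opp r c" using assms(2) by (auto simp: opp_def)
    then show ?thesis using assms(5)[OF that False] by (auto simp: bottom_def)
  qed
  then show eq: "bottom h = {b}" using b by blast
  have "c \<in> second h" "d \<in> second h"
    using assms by (auto simp: second_def eq opp_def)
  then show "\<not> is_singleton (second h)" using assms(4) by (auto simp: is_singleton_def)
qed

text \<open>Ranks separate strictly ordered letters by at least 1, so the half added to positive
  letters breaks ties between opposite letters without disturbing the order of \<open>z\<close>. The
  bounds leave room to place letters below and above.\<close>

lemma ex_proper_refinement:
  fixes z :: "'a::finite + 'b::finite \<Rightarrow> real"
  obtains m :: "'a + 'b \<Rightarrow> real" and K where "proper m" "compatible m z" "\<And>s. 0 \<le> m s \<and> m s < K"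
proof -
  define rank where "rank s = card {t. z t < z s}" for s
  define m where "m s = real (rank s) + (if isl s then 1 / 2 else 0)" for s
  have rank_mono: "rank s < rank t" if "z s < z t" for s t
    unfolding rank_def by (intro psubset_card_mono) (use that in auto)
  have ne: "m s \<noteq> m t" if "opp s t" for s t
  proof
    assume eq: "m s = m t"
    have "2 * rank s + (if isl s then 1 else 0) = 2 * rank t + (if isl t then 1 else 0)"
      using eq unfolding m_def by (auto split: if_splits)
    then show False using that by (auto simp: opp_def split: if_splits) presburger+
  qed
  have "z s \<le> z t" if "m s < m t" for s t
  proof (rule ccontr)
    assume "\<not> z s \<le> z t"
    then have "rank t + 1 \<le> rank s" using rank_mono[of t s] by simp
    then have "real (rank t) + 1 \<le> real (rank s)" by linarith
    then show False using that by (auto simp: m_def split: if_splits)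
  qed
  then have "compatible m z" by (auto simp: compatible_def)
  moreover have "0 \<le> m s \<and> m s < Max (range m) + 1" for s
  proof -
    have "m s \<le> Max (range m)" by (rule Max_ge) auto
    moreover have "0 \<le> m s" by (simp add: m_def)
    ultimately show ?thesis by linarith
  qed
  ultimately show ?thesis using that ne by (auto simp: proper_def)
qed

text \<open>The two letters at \<open>L\<close>, one of each sign, may start the order in either
  arrangement, since they are tied. Giving the first one the sign of the lowest remaining letter
  isolates the second in its block; the letters at \<open>T\<close> are treated in the same way at
  the end.\<close>

lemma ex_small_compatible:
  fixes z :: "'a::finite + 'b::finite \<Rightarrow> real"
  assumes bnd: "\<And>s. L \<le> z s \<and> z s \<le> T"
    and pairs: "\<And>s. \<exists>b t. \<not> opp s b \<and> \<not> opp s t \<and> b \<noteq> t \<and> z b = L \<and> z t = T"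
  shows "\<exists>h. proper h \<and> small h \<and> compatible h z"
proof -
  obtain m K where m: "proper m" "compatible m z" and mK: "\<And>s. 0 \<le> m s \<and> m s < (K :: real)"
    using ex_proper_refinement[of z] by blast
  obtain bx tx where x: "isl bx" "isl tx" "bx \<noteq> tx" "z bx = L" "z tx = T"
    using pairs[of "Inl undefined"] by (auto simp: opp_def)
  obtain yb yt where y: "\<not> isl yb" "\<not> isl yt" "yb \<noteq> yt" "z yb = L" "z yt = T"
    using pairs[of "Inr undefined"] by (auto simp: opp_def)
  define Mid where "Mid = - {bx, tx, yb, yt}"
  have "\<exists>b b' t t'. {b, b'} = {bx, yb} \<and> {t, t'} = {tx, yt} \<and> opp b b' \<and> opp t t' \<and>
      ((\<exists>u\<in>Mid. \<not> opp b u \<and> (\<forall>r\<in>Mid. m u \<le> m r)) \<and> (\<exists>u\<in>Mid. \<not> opp t u \<and> (\<forall>r\<in>Mid. m r \<le> m u))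
        \<or> Mid = {} \<and> \<not> opp b t')"
  proof (cases "Mid = {}")
    case True
    \<comment> \<open>With four letters the two ends must fit each other: \<open>bx\<close>,
      \<open>yb\<close>, \<open>tx\<close>, \<open>yt\<close> alternates in sign.\<close>
    then show ?thesis
      using x y by (intro exI[of _ bx] exI[of _ yb] exI[of _ yt] exI[of _ tx]) (auto simp: opp_def)
  next
    case False
    obtain u where u: "u \<in> Mid" "\<And>r. r \<in> Mid \<Longrightarrow> m u \<le> m r"
      using ex_min_if_finite[of "m ` Mid"] False by (auto simp: not_less)
    obtain w where w: "w \<in> Mid" "\<And>r. r \<in> Mid \<Longrightarrow> m r \<le> m w"
      using ex_min_if_finite[of "(\<lambda>s. - m s) ` Mid"] False by (auto simp: not_less)
    show ?thesis
      by (rule exI[of _ "if isl u then bx else yb"], rule exI[of _ "if isl u then yb else bx"],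
          rule exI[of _ "if isl w then tx else yt"], rule exI[of _ "if isl w then yt else tx"])
        (use x y u w in \<open>auto simp: opp_def\<close>)
  qed
  then obtain b b' t t' where bt: "{b, b'} = {bx, yb}" "{t, t'} = {tx, yt}" "opp b b'" "opp t t'"
    and ends: "(\<exists>u\<in>Mid. \<not> opp b u \<and> (\<forall>r\<in>Mid. m u \<le> m r)) \<and> (\<exists>u\<in>Mid. \<not> opp t u \<and> (\<forall>r\<in>Mid. m r \<le> m u))
        \<or> Mid = {} \<and> \<not> opp b t'"
    by blast
  have Mid: "r \<in> Mid \<longleftrightarrow> r \<notin> {b, b'} \<and> r \<notin> {t, t'}" for r
    unfolding bt Mid_def by auto
  have dis: "{b, b'} \<inter> {t, t'} = {}" unfolding bt using x y by auto
  have ne: "b \<noteq> b'" "t \<noteq> t'" "b \<noteq> t" "b \<noteq> t'" "b' \<noteq> t" "b' \<noteq> t'"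
    using dis bt(3,4) by (auto simp: opp_def)
  have "z s = L" if "s \<in> {b, b'}" for s using that x y unfolding bt by auto
  then have zb: "z b = L" "z b' = L" by auto
  have "z s = T" if "s \<in> {t, t'}" for s using that x y unfolding bt by auto
  then have zt: "z t = T" "z t' = T" by auto
  define h where "h s = (if s = b then - 2 else if s = b' then - 1 else
     if s = t then K + 2 else if s = t' then K + 1 else m s)" for s
  have K0: "0 < K" using mK[of b] by linarith
  have hb: "h b = - 2" "h b' = - 1" "h t = K + 2" "h t' = K + 1"
    using ne by (auto simp: h_def)
  have hm: "h r = m r" if "r \<in> Mid" for r using that by (auto simp: h_def Mid)
  have cases4: "r = b \<or> r = b' \<or> r = t \<or> r = t' \<or> r \<in> Mid" for r by (auto simp: Mid)
  have low: "h b < h r" if "r \<noteq> b" for r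
    using cases4[of r] that hb hm[of r] mK[of r] K0 by auto
  have low': "h b' < h r" if "r \<noteq> b" "r \<noteq> b'" for r
    using cases4[of r] that hb hm[of r] mK[of r] K0 by auto
  have high: "h r < h t" if "r \<noteq> t" for r
    using cases4[of r] that hb hm[of r] mK[of r] K0 by auto
  have high': "h r < h t'" if "r \<noteq> t" "r \<noteq> t'" for r
    using cases4[of r] that hb hm[of r] mK[of r] K0 by auto
  have "h r \<noteq> h s" if "opp r s" for r s
  proof -
    have rs: "r \<noteq> s" using that by (auto simp: opp_def)
    consider "r \<in> Mid" "s \<in> Mid" | "r \<in> {b, b', t, t'}" | "s \<in> {b, b', t, t'}"
      using cases4[of r] cases4[of s] by auto
    then show ?thesis
    proof cases
      case 1
      then show ?thesis using that m(1) hm by (auto simp: proper_def)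
    next
      case 2
      then show ?thesis
        using rs low[of s] low'[of s] high[of s] high'[of s] ne hb K0 by (smt (verit) insertE singletonD)
    next
      case 3
      then show ?thesis
        using rs low[of r] low'[of r] high[of r] high'[of r] ne hb K0 by (smt (verit) insertE singletonD)
    qed
  qed
  then have proper: "proper h" by (simp add: proper_def)
  have "z r \<le> z s" if "opp r s" "h r < h s" for r s
  proof -
    consider "r \<in> Mid" "s \<in> Mid" | "r = b \<or> r = b'" | "s = t \<or> s = t'" | "r = t" | "r = t'" | "s = b" | "s = b'"
      using cases4[of r] cases4[of s] by auto
    then show ?thesis
    proof cases
      case 1
      then show ?thesis using that m(2) hm by (auto simp: compatible_def)
    next
      case 2
      then show ?thesis using zb bnd[of s] by auto
    next
      case 3
      then show ?thesis using zt bnd[of r] by auto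
    next
      case 4
      then show ?thesis using that(2) high[of s] by (cases "s = t") auto
    next
      case 5
      then show ?thesis using that(2) high'[of s] zt by (cases "s = t"; cases "s = t'") auto
    next
      case 6
      then show ?thesis using that(2) low[of r] by (cases "r = b") auto
    next
      case 7
      then show ?thesis using that(2) low'[of r] zb by (cases "r = b"; cases "r = b'") auto
    qed
  qed
  then have compat: "compatible h z" by (auto simp: compatible_def)
  have "\<exists>u. u \<noteq> b \<and> u \<noteq> b' \<and> \<not> opp b u \<and> (\<forall>r. r \<noteq> b \<and> r \<noteq> b' \<longrightarrow> h u \<le> h r)"
    using ends
  proof
    assume "(\<exists>u\<in>Mid. \<not> opp b u \<and> (\<forall>r\<in>Mid. m u \<le> m r)) \<and> (\<exists>u\<in>Mid. \<not> opp t u \<and> (\<forall>r\<in>Mid. m r \<le> m u))"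
    then obtain u where u: "u \<in> Mid" "\<not> opp b u" "\<And>r. r \<in> Mid \<Longrightarrow> m u \<le> m r" by blast
    have "h u \<le> h r" if "r \<noteq> b" "r \<noteq> b'" for r
      using cases4[of r] that u hm[of r] hm[of u] hb mK[of u] by auto
    then show ?thesis using u Mid by blast
  next
    assume *: "Mid = {} \<and> \<not> opp b t'"
    then have "h t' \<le> h r" if "r \<noteq> b" "r \<noteq> b'" for r
      using cases4[of r] that hb by auto
    then show ?thesis using * ne by metis
  qed
  then obtain u where "u \<noteq> b" "u \<noteq> b'" "\<not> opp b u" "\<And>r. r \<noteq> b \<Longrightarrow> r \<noteq> b' \<Longrightarrow> h u \<le> h r" by blast
  note B = bottom_second_pair[where h = h, OF bt(3) low[OF ne(1)[symmetric]] low' this]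
  have "\<exists>u. u \<noteq> t \<and> u \<noteq> t' \<and> \<not> opp t u \<and> (\<forall>r. r \<noteq> t \<and> r \<noteq> t' \<longrightarrow> h r \<le> h u)"
    using ends
  proof
    assume "(\<exists>u\<in>Mid. \<not> opp b u \<and> (\<forall>r\<in>Mid. m u \<le> m r)) \<and> (\<exists>u\<in>Mid. \<not> opp t u \<and> (\<forall>r\<in>Mid. m r \<le> m u))"
    then obtain u where u: "u \<in> Mid" "\<not> opp t u" "\<And>r. r \<in> Mid \<Longrightarrow> m r \<le> m u" by blast
    have "h r \<le> h u" if "r \<noteq> t" "r \<noteq> t'" for r
      using cases4[of r] that u hm[of r] hm[of u] hb mK[of u] by auto
    then show ?thesis using u Mid by blast
  next
    assume *: "Mid = {} \<and> \<not> opp b t'"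
    then have "h r \<le> h b'" if "r \<noteq> t" "r \<noteq> t'" for r
      using cases4[of r] that hb by auto
    moreover have "\<not> opp t b'" using * bt(3,4) by (auto simp: opp_def)
    ultimately show ?thesis using ne by metis
  qed
  then obtain w where w: "w \<noteq> t" "w \<noteq> t'" "\<not> opp t w" "\<And>r. r \<noteq> t \<Longrightarrow> r \<noteq> t' \<Longrightarrow> h r \<le> h w" by blast
  have T: "bottom (- h) = {t}" "second (- h) = {t'}"
    using bottom_second_pair[where h = "- h" and b = t and b' = t' and u = w] bt(4) high[OF ne(2)[symmetric]] high' w
    by auto
  have "small h" using B T by (simp add: small_def ends_def)
  then show ?thesis using proper compat by blast
qed

lemma barvinok_subset_small:
  fixes M :: "real^'n::finite^'m::finite"
  assumes card: "CARD('m) \<ge> 2" "CARD('n) \<ge> 2" and M: "M \<in> barvinok_set"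
  shows "\<exists>h. proper h \<and> small h \<and> M \<in> cone_at h"
proof -
  obtain p where p: "M = g p" using M by (auto simp: barvinok_set_def)
  define z where "z = coord p"
  define T where "T = max (lo z) (hi z)"
  have rep: "represents (clamp z) M" using represents_clamp[OF represents_g[of p]] p by (simp add: z_def)
  have "\<exists>b t. \<not> opp s b \<and> \<not> opp s t \<and> b \<noteq> t \<and> clamp z b = lo z \<and> clamp z t = T" for s
  proof (cases "lo z < hi z")
    case True
    obtain b where b: "\<not> opp s b" "z b \<le> lo z" using ex_le_lo by blast
    obtain t where t: "\<not> opp s t" "hi z \<le> z t" using ex_ge_hi by blast
    show ?thesis using True b t by (intro exI[of _ b] exI[of _ t]) (auto simp: clamp_def T_def)
  next
    case False
    \<comment> \<open>All clamped values coincide, so any two letters of a sign can serve as its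
      lowest and highest one.\<close>
    then have c: "clamp z r = lo z" for r by (auto simp: clamp_def)
    have TT: "T = lo z" using False by (simp add: T_def)
    obtain r where r: "opp r s" by (metis sum.exhaust opp_simps(1,2))
    have "2 \<le> card {q. opp r q}" using card by (simp add: card_opp)
    then obtain b t where "b \<in> {q. opp r q}" "t \<in> {q. opp r q}" "b \<noteq> t"
      by (metis card_2_iff' card_le_Suc0_iff_eq finite numeral_2_eq_2 not_less_eq_eq)
    then show ?thesis using r c TT by (intro exI[of _ b] exI[of _ t]) (auto simp: opp_def)
  qed
  moreover have "lo z \<le> clamp z s \<and> clamp z s \<le> T" for s
    by (auto simp: clamp_def T_def)
  ultimately obtain h where "proper h" "small h" "compatible h (clamp z)"
    using ex_small_compatible[of "lo z" "clamp z" T] by blast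
  then show ?thesis using rep mem_cone_at_iff by blast
qed

text \<open>\<open>t0\<close>, alone in the second block, is lowest of its sign in every compatible
  \<open>z\<close>. Clamping puts it at \<open>lo z\<close>, so it may move to the very beginning;
  the former first letter then merges with the third block, and the new second block has at least
  two letters. The upper end is symmetric.\<close>

lemma small_subset_large_levels:
  fixes pos :: "'m::finite + 'n::finite \<Rightarrow> nat"
  assumes card: "CARD('m) \<ge> 2" "CARD('n) \<ge> 2"
    and L: "levels UNIV pos N" and small: "small (\<lambda>s. real (pos s))"
  shows "\<exists>k. proper k \<and> large k \<and> cone_at (\<lambda>s. real (pos s)) \<subseteq> (cone_at k :: (real^'n^'m) set)"
proof -
  have lt: "pos s < N" for s using L by (auto simp: levels_def)
  have ex: "\<exists>s. pos s = k" if "k < N" for k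
    using L that unfolding levels_def by (metis imageE lessThan_iff)
  note opp = levels_opp_iff[OF L]
  have sing: "is_singleton {s. pos s = 0}" "is_singleton {s. pos s = 1}"
    "is_singleton {s. pos s = N - 1}" "is_singleton {s. pos s = N - 2}"
    using small bottom_levels[OF L] top_levels[OF L] by (auto simp: small_def ends_def)
  then obtain s0 t0 s1 t1 where "{s. pos s = 0} = {s0}" "{s. pos s = 1} = {t0}"
    "{s. pos s = N - 1} = {s1}" "{s. pos s = N - 2} = {t1}"
    unfolding is_singleton_def by blast
  then have s0: "pos s = 0 \<longleftrightarrow> s = s0" and t0: "pos s = 1 \<longleftrightarrow> s = t0"
    and s1: "pos s = N - 1 \<longleftrightarrow> s = s1" and t1: "pos s = N - 2 \<longleftrightarrow> s = t1" for s
    by (simp_all add: set_eq_iff)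
  have N4: "4 \<le> N"
  proof (rule ccontr)
    assume "\<not> 4 \<le> N"
    then have "s = s0 \<or> s = t0 \<or> s = s1" for s
      using lt[of s] s0[of s] t0[of s] s1[of s] by linarith
    then have "UNIV = {s0, t0, s1}" by auto
    then have "CARD('m + 'n) \<le> 3" by (metis card_insert_if card.empty finite.intros One_nat_def Suc_eq_plus1 card_3_iff card_length list.set list.size numeral_3_eq_3 add_0)
    then show False using card by simp
  qed
  \<comment> \<open>For \<open>N = 4\<close>, hence \<open>m = n = 2\<close>, exchanging both ends would again give four singleton blocks.\<close>
  define pos' where "pos' s = (if pos s = 0 then 1 else if pos s = 1 then 0
     else if N \<ge> 5 \<and> pos s = N - 1 then N - 2 else if N \<ge> 5 \<and> pos s = N - 2 then N - 1 else pos s)" for s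
  define k where "k s = real (pos' s)" for s
  have "pos' s \<noteq> pos' t" if "opp s t" for s t
  proof -
    have "pos s \<noteq> pos t" using that L by (auto simp: levels_def)
    then show ?thesis using N4 lt[of s] lt[of t] by (auto simp: pos'_def split: if_splits)
  qed
  then have proper: "proper k" by (simp add: proper_def k_def)
  obtain u where u: "pos u = 2" using ex[of 2] N4 by auto
  obtain w where w: "pos w = N - 3" using ex[of "N - 3"] N4 by auto
  have ps: "pos s0 = 0" "pos t0 = 1" "pos s1 = N - 1" "pos t1 = N - 2"
    using s0 t0 s1 t1 by blast+
  have low: "bottom k = {t0}" "\<not> is_singleton (second k)"
  proof -
    have a: "k t0 < k r" if "r \<noteq> t0" for r
      using that t0[of r] N4 ps by (auto simp: k_def pos'_def)
    have b: "opp t0 s0" "opp t0 u" "s0 \<noteq> u" using ps u by (auto simp: opp)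
    have c: "k s0 < k r \<and> k u < k r" if "r \<noteq> t0" "\<not> opp t0 r" for r
    proof -
      have "odd (pos r)" "pos r \<noteq> 1" using that ps t0[of r] by (auto simp: opp)
      then have "pos r \<ge> 3" by presburger
      then show ?thesis using ps u N4 \<open>odd (pos r)\<close> by (auto simp: k_def pos'_def)
    qed
    show "bottom k = {t0}" "\<not> is_singleton (second k)"
      using bottom_second_large[of t0 k s0 u, OF a b c] by auto
  qed
  have high: "is_singleton (bottom (- k)) \<and> \<not> is_singleton (second (- k))"
  proof (cases "5 \<le> N")
    case True
    have pw: "pos' w = N - 3" "pos' s1 = N - 2" "pos' t1 = N - 1" using True w ps by (auto simp: pos'_def)
    have a: "(- k) t1 < (- k) r" if "r \<noteq> t1" for r
    proof -
      have "pos' r < N - 1" using that t1[of r] True lt[of r] by (auto simp: pos'_def)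
      then show ?thesis using pw by (simp add: k_def)
    qed
    have b: "opp t1 s1" "opp t1 w" "s1 \<noteq> w" using ps w True by (auto simp: opp)
    have c: "(- k) s1 < (- k) r \<and> (- k) w < (- k) r" if "r \<noteq> t1" "\<not> opp t1 r" for r
    proof -
      have "even (pos r) = even (N - 2)" "pos r \<noteq> N - 2" using that ps t1[of r] by (auto simp: opp)
      then have "pos r < N - 3" using lt[of r] True by (cases "pos r = N - 3"; cases "pos r = N - 1") auto
      then have "pos' r < N - 3"
        using \<open>even (pos r) = even (N - 2)\<close> True by (auto simp: pos'_def)
      then show ?thesis using pw by (auto simp: k_def)
    qed
    show ?thesis using bottom_second_large[of t1 "- k" s1 w, OF a b c] by (auto simp: is_singleton_def)
  next
    case False
    then have N: "N = 4" using N4 by simp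
    have pw: "pos' s1 = 3" "pos' t1 = 2" "pos' s0 = 1" "pos' t0 = 0" using N ps by (auto simp: pos'_def)
    have p4: "pos r < 4" for r using lt N by auto
    have a: "(- k) s1 < (- k) r" if "r \<noteq> s1" for r
      using that s1[of r] N p4[of r] pw by (auto simp: k_def pos'_def)
    have b: "opp s1 t1" "opp s1 s0" "t1 \<noteq> s0" using ps N by (auto simp: opp)
    have c: "(- k) t1 < (- k) r \<and> (- k) s0 < (- k) r" if "r \<noteq> s1" "\<not> opp s1 r" for r
    proof -
      have "odd (pos r)" "pos r \<noteq> 3" using that ps N s1[of r] by (auto simp: opp)
      then have "pos r = 1" using p4[of r] by presburger
      then show ?thesis using t0 pw by (simp add: k_def)
    qed
    show ?thesis using bottom_second_large[of s1 "- k" t1 s0, OF a b c] by (auto simp: is_singleton_def)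
  qed
  have "large k" using low high by (simp add: large_def ends_def)
  moreover have "M \<in> cone_at k" if M: "M \<in> cone_at (\<lambda>s. real (pos s))" for M :: "real^'n^'m"
  proof -
    obtain z where z: "compatible (\<lambda>s. real (pos s)) z" "represents z M"
      using M mem_cone_at_iff[OF levels_proper[OF L]] by blast
    have zD: "z s \<le> z t" if "opp s t" "pos s < pos t" for s t
      using z(1) that by (auto simp: compatible_def)
    have min: "z t0 \<le> z r" if "\<not> opp t0 r" for r
    proof (cases "r = t0")
      case False
      have "odd (pos r)" "pos r \<noteq> 1" using that ps t0[of r] False by (auto simp: opp)
      then have "pos r \<ge> 3" by presburger
      then show ?thesis using zD[of t0 u] zD[of u r] u ps \<open>odd (pos r)\<close> by (auto simp: opp)
    qed auto
    have max: "z r \<le> z t1" if "\<not> opp t1 r" "5 \<le> N" for r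
    proof (cases "r = t1")
      case False
      have "even (pos r) = even (N - 2)" "pos r \<noteq> N - 2" using that ps t1[of r] False by (auto simp: opp)
      then have "pos r < N - 3" using lt[of r] that(2) by (cases "pos r = N - 3"; cases "pos r = N - 1") auto
      moreover have "opp r w" "opp w t1" using \<open>even (pos r) = even (N - 2)\<close> w ps that(2) by (auto simp: opp)
      moreover have "pos w < pos t1" using w ps that(2) by simp
      ultimately show ?thesis using zD[of r w] zD[of w t1] w by force
    qed auto
    obtain r where "\<not> opp t0 r" "z r \<le> lo z" using ex_le_lo by blast
    then have zt0: "z t0 \<le> lo z" using min[of r] by simp
    obtain r where "\<not> opp t1 r" "hi z \<le> z r" using ex_ge_hi by blast
    then have zt1: "hi z \<le> z t1" if "5 \<le> N" using max[of r] that by simp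
    have "clamp z s \<le> clamp z t" if st: "opp s t" "k s < k t" for s t
    proof (cases "pos s < pos t")
      case True
      then show ?thesis using zD st(1) clamp_mono by blast
    next
      case False
      then have "pos t < pos s" using st(1) opp by (metis linorder_neqE_nat)
      \<comment> \<open>The exchanged neighbours are the only opposite pairs whose order
        \<open>k\<close> reverses.\<close>
      then have "pos s = 1 \<and> pos t = 0 \<or> 5 \<le> N \<and> pos s = N - 1 \<and> pos t = N - 2"
        using st(2) lt[of s] lt[of t] by (auto simp: k_def pos'_def split: if_splits)
      then show ?thesis
      proof
        assume "pos s = 1 \<and> pos t = 0"
        then have "s = t0" using t0 by blast
        then show ?thesis using zt0 by (auto simp: clamp_def)
      next
        assume "5 \<le> N \<and> pos s = N - 1 \<and> pos t = N - 2"
        then have "t = t1" "5 \<le> N" using t1 by blast+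
        then show ?thesis using zt1 by (auto simp: clamp_def)
      qed
    qed
    then have "compatible k (clamp z)" by (auto simp: compatible_def)
    then show ?thesis using mem_cone_at_iff[OF proper] represents_clamp[OF z(2)] by blast
  qed
  ultimately show ?thesis using proper by blast
qed

lemma small_subset_large:
  fixes h :: "'m::finite + 'n::finite \<Rightarrow> real"
  assumes "CARD('m) \<ge> 2" "CARD('n) \<ge> 2" "proper h" "small h"
  shows "\<exists>k. proper k \<and> large k \<and> cone_at h \<subseteq> cone_at k"
proof -
  obtain pos :: "'m + 'n \<Rightarrow> nat" and N where L: "levels UNIV pos N"
    and eq: "\<And>s t. opp s t \<Longrightarrow> h s < h t \<longleftrightarrow> real (pos s) < real (pos t)"
    using proper_levels[OF assms(3)] by blast
  have "small (\<lambda>s. real (pos s))"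
    using assms(4) order_cong[of h "\<lambda>s. real (pos s)", OF eq] by (simp add: small_def ends_def)
  moreover have "below h = below (\<lambda>s. real (pos s))" using eq by (auto simp: below_def fun_eq_iff)
  ultimately show ?thesis using small_subset_large_levels[OF assms(1,2) L] by simp
qed

lemma cone_at_subset_barvinok: "proper h \<Longrightarrow> cone_at h \<subseteq> barvinok_set"
  unfolding barvinok_set_def using mem_cone_at_iff represents_imp_ex_g by (metis rangeI subsetI)

text \<open>Common to both collections; \<open>sizes\<close> records that the face property is
  available for two cells of the same kind. Finiteness holds because a cone depends only on a
  boolean pattern on a finite grid.\<close>

lemma polyhedral_subdivision_cones:
  fixes Q :: "('m::finite + 'n::finite \<Rightarrow> real) \<Rightarrow> bool"
  assumes card: "CARD('m) \<ge> 2" "CARD('n) \<ge> 2"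
    and cover: "\<And>M :: real^'n^'m. M \<in> barvinok_set \<Longrightarrow> \<exists>h. proper h \<and> Q h \<and> M \<in> cone_at h"
    and sizes: "\<And>h k. Q h \<Longrightarrow> Q k \<Longrightarrow> large h \<and> large k \<or> small h \<and> small k"
  shows "polyhedral_subdivision {cone_at h |h. proper h \<and> Q h} (barvinok_set :: (real^'n^'m) set)"
proof -
  let ?C = "{cone_at h |h. proper h \<and> Q h} :: (real^'n^'m) set set"
  have "finite ?C" by (rule finite_subset[of _ "range cone_of"]) auto
  moreover have "\<forall>P\<in>?C. polyhedron P" using polyhedron_cone_of by auto
  moreover have sub: "\<forall>P\<in>?C. P \<subseteq> barvinok_set" using cone_at_subset_barvinok by auto
  moreover have "\<Union>?C = barvinok_set" using sub cover by blast
  moreover have "P \<inter> R face_of P \<and> P \<inter> R face_of R" if PR: "P \<in> ?C" "R \<in> ?C" for P R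
  proof -
    obtain h k where "P = cone_at h" "proper h" "Q h" "R = cone_at k" "proper k" "Q k"
      using PR by blast
    then show ?thesis
      using cone_Int_face[of h k] cone_Int_face[of k h] card sizes[of h k] sizes[of k h]
      by (simp add: Int_commute)
  qed
  ultimately show ?thesis unfolding polyhedral_subdivision_def by blast
qed

theorem theorem1:
  assumes "CARD('m::finite) \<ge> 2" and "CARD('n::finite) \<ge> 2"
  shows "polyhedral_subdivision (large_cells :: (real^'n^'m) set set) barvinok_set \<and>
         polyhedral_subdivision (small_cells :: (real^'n^'m) set set) barvinok_set \<and>
         refines_subdivision (small_cells :: (real^'n^'m) set set) large_cells"
proof (intro conjI)
  show "polyhedral_subdivision (small_cells :: (real^'n^'m) set set) barvinok_set"
    unfolding small_cells_eq[OF assms]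
    using polyhedral_subdivision_cones[OF assms, of small] barvinok_subset_small[OF assms] by blast
  have large: "\<exists>h. proper h \<and> large h \<and> M \<in> cone_at h" if "M \<in> barvinok_set" for M :: "real^'n^'m"
    using barvinok_subset_small[OF assms that] small_subset_large[OF assms] by blast
  show "polyhedral_subdivision (large_cells :: (real^'n^'m) set set) barvinok_set"
    unfolding large_cells_eq[OF assms] by (intro polyhedral_subdivision_cones[OF assms] large) auto
  show "refines_subdivision (small_cells :: (real^'n^'m) set set) large_cells"
    unfolding refines_subdivision_def large_cells_eq[OF assms] small_cells_eq[OF assms]
  proof clarify
    fix h :: "'m + 'n \<Rightarrow> real" assume "proper h" "small h"
    then obtain k where "proper k" "large k" "(cone_at h :: (real^'n^'m) set) \<subseteq> cone_at k"
      using small_subset_large[OF assms] by blast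
    then show "\<exists>Q\<in>{cone_at k |k. proper k \<and> large k}. (cone_at h :: (real^'n^'m) set) \<subseteq> Q"
      by blast
  qed
qed

end
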